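(* Let $A=\mathbb Z[x]/(x^2)$, concentrated in degree $0$, be the symmetric Frobenius algebra with coproduct $\nu(1)=1\otimes x+x\otimes1$, $\nu(x)=x\otimes x$, viewed as an $H_0(\mathcal O)$-algebra, and let $$F:\mathcal{SD}\big((1,0),(1,0)\big)\otimes C_*(A,A)\to C_*(A,A)$$ be the action of Sullivan diagrams on the (reduced) Hochschild complex of $A$. Let $g\ge1$, let $t_g\in\mathcal{SD}((1,0),(1,0))$ be the degree $2g+1$ Sullivan diagram described in the context, and let $x\in C_0(A,A)=A$. Then $$F(t_g\otimes x)=1\otimes x\otimes\dots\otimes x\in C_{2g+1}(A,A)$$ (with $2g+1$ factors $x$). In particular, $H_*(F(t_g\otimes-)):HH_0(A,A)\to HH_{2g+1}(A,A)$ is non-zero, also with rational coefficients.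
   Context: Reduced Hochschild complex of $A$: $C_n(A,A)=A\otimes(A/\mathbb Z1)^{\otimes n}$, $n\ge 0$, with the usual Hochschild differential; $HH_*(A,A)$ is its homology. Black and white graphs: fat graphs (cyclic ordering of the half-edges at each vertex) with black vertices of valence $\ge3$, white vertices of any valence $\ge1$ each with a chosen start half-edge, and labelled leaves (an unlabelled leaf is allowed only as start half-edge of a white vertex). Boundary cycles are the boundary components of the ribbon surface not surrounding white vertices. An orientation is a unit vector in $\det(\mathbb R(V\sqcup H))$ ($V$ vertices, $H$ half-edges; reversing it multiplies by $-1$); the degree is $\sum_{\text{black}}(|v|-3)+\sum_{\text{white}}(|v|-1)$; the differential is the sum of all blow-ups (graphs with an edge whose collapse gives back the graph), a white vertex blowing up into a white and a black vertex. $\mathcal{SD}((n_1,0),(1,0))$, the complex of Sullivan diagrams with one white vertex (the outgoing circle) and $n_1$ leaves, each being the only labelled leaf in its boundary cycle (the incoming circles), is the quotient of the complex of such black and white graphs by the graphs having a black vertex of valence $\ge4$ and their boundaries. Action: $H_0(\mathcal O)$ is the prop whose morphisms $n\to m$ are freely generated by topological types of cobordisms from $n$ to $m$ intervals ($H_0$ of complexes of fat graphs with $n+m$ labelled leaves); its algebras are exactly symmetric Frobenius algebras. Cutting around the white vertex writes a Sullivan diagram $G$ with white vertex of valence $k$ as a morphism $\Gamma\in H_0(\mathcal O)(n_1,k)$ whose $k$ outputs are attached, in order from the start half-edge, to the white vertex. The action is the chain map $F:\mathcal{SD}((n_1,0),(1,0))\otimes C_*(A,A)^{\otimes n_1}\to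 C_*(A,A)$ given on $C_{j_1-1}(A,A)\otimes\dots\otimes C_{j_{n_1}-1}(A,A)$ as follows: sum over all diagrams obtained from $G$ by attaching $j_i-1$ further labelled leaves, in cyclic order after the $i$th leaf, at corners of the vertices of the $i$th incoming boundary cycle (for each $i$); then cut around the white vertex and apply the resulting morphism of $H_0(\mathcal O)$ to the tensor factors, reading the resulting element of $A^{\otimes k}$ as a Hochschild chain in $C_{k-1}(A,A)$. On $C_0(A,A)^{\otimes n_1}=A^{\otimes n_1}$ this is $F(G\otimes a)=\Gamma(a)\in A^{\otimes k}$, viewed in $C_{k-1}(A,A)$. The diagrams: let the white vertex have half-edges $h_1,\dots,h_{2g+2}$ in cyclic order with $h_1$ the start half-edge. $\mu_g$ is obtained by connecting the odd half-edges $h_1,h_3,\dots,h_{2g+1}$ by a trivalent tree embedded so that the graph is planar (for $g=1$, just an edge joining $h_1$ and $h_3$), the even half-edges $h_2,h_4,\dots,h_{2g+2}$ remaining leaves labelled $1,\dots,g+1$ in their cyclic order. $t_g$ is obtained from $\mu_g$ by connecting the even half-edges by a second trivalent tree (with the same kind of cyclic ordering as the first: together with the white vertex it forms a planar graph), carrying one extra leaf, placed between the branches of $h_{2g+2}$ and $h_2$, which is the incoming leaf. $t_g$ is a cycle of degree $2g+1$; its underlying cobordism has genus $g$ with one incoming and one outgoing circle. Read as operations on $A$, the first tree gives the iterated coproduct $\nu^g(1)\in A^{\otimes g+1}$ placed in the odd positions and the second tree gives the iterated coproduct $\nu^g$ of the input placed in the even positions. The orientation (overall sign) of $t_g$ is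 chosen accordingly. *)

theory Defs
  imports Complex_Main "HOL-Library.Poly_Mapping" "HOL-Library.FuncSet"
begin

section \<open>The algebra R[x]/(x^2) and its reduced Hochschild complex\<close>

text \<open>
  Everything is done over a coefficient ring R, to be instantiated with the integers and the
  rationals.  A = R[x]/(x^2) has the basis x^0, x^1, and a basis element is denoted by its
  exponent.  The list [i0,...,in] stands for the tensor x^i0 (x) ... (x) x^in, and elements of
  tensor powers are finitely supported functions on lists.
\<close>

definition scale :: "'r::comm_ring_1 \<Rightarrow> ('b \<Rightarrow>\<^sub>0 'r) \<Rightarrow> ('b \<Rightarrow>\<^sub>0 'r)" where
  "scale r = Poly_Mapping.map (\<lambda>y. r * y)"

definition lin_ext :: "('a \<Rightarrow> 'b \<Rightarrow>\<^sub>0 'r) \<Rightarrow> ('a \<Rightarrow>\<^sub>0 'r::comm_ring_1) \<Rightarrow> 'b \<Rightarrow>\<^sub>0 'r" where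
  "lin_ext f c = (\<Sum>w\<in>Poly_Mapping.keys c. scale (Poly_Mapping.lookup c w) (f w))"

text \<open>
  Structure constants of the Frobenius algebra: \<open>mult a b c\<close> is the coefficient of x^c in
  x^a x^b, \<open>comult a b c\<close> the coefficient of x^b (x) x^c in nu(x^a), and \<open>counit\<close> is the counit
  of nu, which is also the trace of the Frobenius structure.
\<close>

definition mult :: "nat \<Rightarrow> nat \<Rightarrow> nat \<Rightarrow> 'r::comm_ring_1" where
  "mult a b c = (if a + b = c \<and> c < 2 then 1 else 0)"

definition comult :: "nat \<Rightarrow> nat \<Rightarrow> nat \<Rightarrow> 'r::comm_ring_1" where
  "comult a b c =
     (if (a, b, c) \<in> {(0, 0, 1), (0, 1, 0), (1, 1, 1)} then 1 else 0)"

definition counit :: "nat \<Rightarrow> 'r::comm_ring_1" where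
  "counit a = (if a = 1 then 1 else 0)"

lemma counit_left:
  assumes "a < 2" "c < 2"
  shows "(\<Sum>b<2. counit b * comult a b c) = (if a = c then 1 else 0 :: 'r::comm_ring_1)"
  using assms by (auto simp: counit_def comult_def numeral_2_eq_2 less_Suc_eq)

lemma frobenius_relation:
  assumes "a < 2" "b < 2" "c < 2" "d < 2"
  shows "(\<Sum>e<2. mult a b e * comult e c d) =
         (\<Sum>e<2. comult b e d * mult a e c :: 'r::comm_ring_1)"
  using assms by (auto simp: mult_def comult_def numeral_2_eq_2 less_Suc_eq)

text \<open>
  As A/R1 is free on the class of x, the module A (x) (A/R1)^n has as basis the words of length
  n + 1 with all entries after the first equal to 1.  \<open>tens w\<close> is the class of the tensor denoted
  by an arbitrary word of exponents: it vanishes if some exponent is at least 2 (as x^2 = 0), and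
  if the unit occurs after the first position.
\<close>

definition reduced_word :: "nat list \<Rightarrow> bool" where
  "reduced_word w \<longleftrightarrow> w \<noteq> [] \<and> hd w < 2 \<and> set (tl w) \<subseteq> {1}"

definition tens :: "nat list \<Rightarrow> nat list \<Rightarrow>\<^sub>0 'r::comm_ring_1" where
  "tens w = (if reduced_word w then Poly_Mapping.single w 1 else 0)"

definition hoch_chains :: "nat \<Rightarrow> (nat list \<Rightarrow>\<^sub>0 'r::comm_ring_1) set" where
  "hoch_chains n = {c. Poly_Mapping.keys c \<subseteq> {w. length w = Suc n \<and> reduced_word w}}"

definition hoch_diff_word :: "nat list \<Rightarrow> nat list \<Rightarrow>\<^sub>0 'r::comm_ring_1" where
  "hoch_diff_word w =
     (if length w \<le> 1 then 0
      else (\<Sum>i<length w - 1.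
              scale ((- 1) ^ i) (tens (take i w @ [w ! i + w ! Suc i] @ drop (i + 2) w)))
         + scale ((- 1) ^ (length w - 1)) (tens ((last w + hd w) # butlast (tl w))))"

definition hoch_diff :: "(nat list \<Rightarrow>\<^sub>0 'r) \<Rightarrow> nat list \<Rightarrow>\<^sub>0 'r::comm_ring_1" where
  "hoch_diff = lin_ext hoch_diff_word"

definition hoch_cycles :: "nat \<Rightarrow> (nat list \<Rightarrow>\<^sub>0 'r::comm_ring_1) set" where
  "hoch_cycles n = {c \<in> hoch_chains n. hoch_diff c = 0}"

definition hoch_boundaries :: "nat \<Rightarrow> (nat list \<Rightarrow>\<^sub>0 'r::comm_ring_1) set" where
  "hoch_boundaries n = hoch_diff ` hoch_chains (Suc n)"

definition hh_class :: "nat \<Rightarrow> (nat list \<Rightarrow>\<^sub>0 'r) \<Rightarrow> (nat list \<Rightarrow>\<^sub>0 'r::comm_ring_1) set" where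
  "hh_class n z = {z + b | b. b \<in> hoch_boundaries n}"

definition HH :: "nat \<Rightarrow> (nat list \<Rightarrow>\<^sub>0 'r::comm_ring_1) set set" where
  "HH n = hh_class n ` hoch_cycles n"


section \<open>Oriented black and white graphs with one white vertex\<close>

text \<open>
  Vertices and half-edges are natural numbers.  \<open>src\<close> is the vertex of a half-edge, \<open>opp\<close> the
  involution whose fixed points are the leaves and whose other orbits are the edges, and \<open>nxt\<close>
  the cyclic ordering of the half-edges at each vertex.  \<open>labs\<close> lists the labelled leaves in the
  order of their labels.  The list \<open>orient\<close> of all vertices and half-edges stands for the wedge
  product of its entries.
\<close>

record bwgraph =
  verts :: "nat set"
  hedges :: "nat set"
  src :: "nat \<Rightarrow> nat"
  opp :: "nat \<Rightarrow> nat"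
  nxt :: "nat \<Rightarrow> nat"
  white :: nat
  start :: nat
  labs :: "nat list"
  orient :: "nat list"

definition hedges_at :: "bwgraph \<Rightarrow> nat \<Rightarrow> nat set" where
  "hedges_at G v = {h \<in> hedges G. src G h = v}"

definition black :: "bwgraph \<Rightarrow> nat set" where
  "black G = verts G - {white G}"

text \<open>The half-edges at the vertex of h, in cyclic order and beginning with h.\<close>

definition cyc :: "bwgraph \<Rightarrow> nat \<Rightarrow> nat list" where
  "cyc G h = map (\<lambda>i. (nxt G ^^ i) h) [0..<card (hedges_at G (src G h))]"

definition bw_graph :: "nat \<Rightarrow> bwgraph \<Rightarrow> bool" where
  "bw_graph n G \<longleftrightarrow>
     finite (verts G) \<and> finite (hedges G) \<and> verts G \<inter> hedges G = {} \<and>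
     (\<forall>h\<in>hedges G. src G h \<in> verts G \<and>
        opp G h \<in> hedges G \<and> opp G (opp G h) = h \<and>
        nxt G h \<in> hedges G \<and> distinct (cyc G h) \<and> set (cyc G h) = hedges_at G (src G h) \<and>
        nxt G (last (cyc G h)) = h) \<and>
     (\<forall>v\<in>black G. card (hedges_at G v) \<ge> 3) \<and>
     white G \<in> verts G \<and> start G \<in> hedges_at G (white G) \<and>
     length (labs G) = n \<and> distinct (labs G) \<and>
     set (labs G) \<subseteq> {h \<in> hedges G. opp G h = h} \<and>
     {h \<in> hedges G. opp G h = h} \<subseteq> insert (start G) (set (labs G)) \<and>
     distinct (orient G) \<and> set (orient G) = verts G \<union> hedges G"

definition degree :: "bwgraph \<Rightarrow> nat" where
  "degree G =
     (\<Sum>v\<in>black G. card (hedges_at G v) - 3) + (card (hedges_at G (white G)) - 1)"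

definition unlabelled_start :: "bwgraph \<Rightarrow> bool" where
  "unlabelled_start G \<longleftrightarrow> opp G (start G) = start G \<and> start G \<notin> set (labs G)"

text \<open>
  The boundary cycles are the orbits of \<open>bd_step\<close>: starting with h one passes to the other end
  \<open>opp G h\<close> and turns the corner between that half-edge and its successor.
\<close>

definition bd_step :: "bwgraph \<Rightarrow> nat \<Rightarrow> nat" where
  "bd_step G h = nxt G (opp G h)"

text \<open>Generators of SD((n,0),(1,0)): each labelled leaf is alone in its boundary cycle.\<close>

definition sd_diagram :: "nat \<Rightarrow> bwgraph \<Rightarrow> bool" where
  "sd_diagram n G \<longleftrightarrow> bw_graph n G \<and>
     (\<forall>l\<in>set (labs G). \<forall>l'\<in>set (labs G). \<forall>k. (bd_step G ^^ k) l = l' \<longrightarrow> l = l')"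

definition bw_iso :: "bwgraph \<Rightarrow> bwgraph \<Rightarrow> bool" where
  "bw_iso G G' \<longleftrightarrow> (\<exists>f.
     inj_on f (verts G \<union> hedges G) \<and>
     verts G' = f ` verts G \<and> hedges G' = f ` hedges G \<and>
     (\<forall>h\<in>hedges G. src G' (f h) = f (src G h) \<and> opp G' (f h) = f (opp G h) \<and>
                     nxt G' (f h) = f (nxt G h)) \<and>
     white G' = f (white G) \<and> start G' = f (start G) \<and>
     labs G' = map f (labs G) \<and> orient G' = map f (orient G))"

text \<open>
  The sign of the permutation sorting a list of distinct numbers.  Two orderings xs, ys of the
  same set satisfy: wedge of xs = \<open>list_sign xs * list_sign ys\<close> times wedge of ys.
\<close>

fun list_sign :: "nat list \<Rightarrow> int" where
  "list_sign [] = 1"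
| "list_sign (x # xs) = (- 1) ^ length (filter (\<lambda>y. y < x) xs) * list_sign xs"


section \<open>The blow-up differential and Sullivan diagrams\<close>

definition fresh :: "bwgraph \<Rightarrow> nat" where
  "fresh G = Suc (Max (verts G \<union> hedges G))"

text \<open>
  The p consecutive half-edges from h onwards are moved from their vertex v to a new black vertex
  u, joined to v by a new edge with half-edges e (at v) and e' (at u).  If the start half-edge of
  the white vertex is among those moved, e becomes the start half-edge.  An orientation v ^ X
  becomes v ^ e ^ u ^ e' ^ X (this expression is symmetric in the two ends of the new edge); the
  sign in front accounts for moving v to the front of \<open>orient G\<close>.
\<close>

definition blow_up :: "bwgraph \<Rightarrow> nat \<Rightarrow> nat \<Rightarrow> bwgraph" where
  "blow_up G h p =
     (let v = src G h; u = fresh G; e = u + 1; e' = u + 2;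
          arc = take p (cyc G h); z = last arc
      in \<lparr> verts = insert u (verts G),
           hedges = {e, e'} \<union> hedges G,
           src = (\<lambda>y. if y = e' \<or> y \<in> set arc then u else if y = e then v else src G y),
           opp = (opp G)(e := e', e' := e),
           nxt = (\<lambda>y. if y = e' then h
                       else if y = z then e'
                       else if y = e then (if nxt G z = h then e else nxt G z)
                       else if nxt G y = h then e
                       else nxt G y),
           white = white G,
           start = (if start G \<in> set arc then e else start G),
           labs = labs G,
           orient = v # e # u # e' # remove1 v (orient G) \<rparr>)"

definition blow_up_sign :: "bwgraph \<Rightarrow> nat \<Rightarrow> int" where
  "blow_up_sign G h = (- 1) ^ length (takeWhile (\<lambda>y. y \<noteq> src G h) (orient G))"

text \<open>
  All blow-ups.  For a black vertex, an arc and the complementary arc describe the same blow-up;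
  each blow-up is counted once by taking the arc which avoids the least half-edge.  At the white
  vertex any number of half-edges (at least 2, possibly all) can move to the black vertex.
  An unlabelled start leaf cannot move, since it is not allowed at a black vertex.
\<close>

definition blow_up_data :: "bwgraph \<Rightarrow> (nat \<times> nat) set" where
  "blow_up_data G =
     {(h, p). h \<in> hedges G \<and> 2 \<le> p \<and>
        (if src G h = white G
         then p \<le> card (hedges_at G (white G)) \<and>
              \<not> (unlabelled_start G \<and> start G \<in> set (take p (cyc G h)))
         else p + 2 \<le> card (hedges_at G (src G h)) \<and>
              Min (hedges_at G (src G h)) \<notin> set (take p (cyc G h)))}"

definition bw_diff :: "bwgraph \<Rightarrow> bwgraph \<Rightarrow>\<^sub>0 int" where
  "bw_diff G = (\<Sum>(h, p)\<in>blow_up_data G.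
     Poly_Mapping.single (blow_up G h p) (blow_up_sign G h))"

text \<open>
  The subgroup of relations of SD((n,0),(1,0)) in the free abelian group on the generators: the
  first two rules identify isomorphic graphs and make reversal of the orientation act by -1, the
  others divide out graphs with a black vertex of valence at least 4 and their boundaries.
\<close>

inductive_set sd_rel :: "nat \<Rightarrow> (bwgraph \<Rightarrow>\<^sub>0 int) set" for n :: nat where
  iso: "\<lbrakk>sd_diagram n G; bw_iso G G'\<rbrakk> \<Longrightarrow>
        Poly_Mapping.single G 1 - Poly_Mapping.single G' 1 \<in> sd_rel n"
| orientation: "\<lbrakk>sd_diagram n G; distinct xs; set xs = set (orient G)\<rbrakk> \<Longrightarrow>
        Poly_Mapping.single G 1 -
        Poly_Mapping.single (G\<lparr>orient := xs\<rparr>) (list_sign (orient G) * list_sign xs) \<in> sd_rel n"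
| high_valence: "\<lbrakk>sd_diagram n G; v \<in> black G; card (hedges_at G v) \<ge> 4\<rbrakk> \<Longrightarrow>
        Poly_Mapping.single G 1 \<in> sd_rel n"
| high_valence_boundary: "\<lbrakk>sd_diagram n G; v \<in> black G; card (hedges_at G v) \<ge> 4\<rbrakk> \<Longrightarrow>
        bw_diff G \<in> sd_rel n"
| zero: "0 \<in> sd_rel n"
| diff: "\<lbrakk>S \<in> sd_rel n; T \<in> sd_rel n\<rbrakk> \<Longrightarrow> S - T \<in> sd_rel n"

definition sd_class :: "nat \<Rightarrow> (bwgraph \<Rightarrow>\<^sub>0 int) \<Rightarrow> (bwgraph \<Rightarrow>\<^sub>0 int) set" where
  "sd_class n T = {T + r | r. r \<in> sd_rel n}"

text \<open>The group of Sullivan diagrams of degree d in SD((n,0),(1,0)).\<close>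

definition SD :: "nat \<Rightarrow> nat \<Rightarrow> (bwgraph \<Rightarrow>\<^sub>0 int) set set" where
  "SD n d = sd_class n ` {T. Poly_Mapping.keys T \<subseteq> {G. sd_diagram n G \<and> degree G = d}}"


section \<open>The action on the Hochschild complex of R[x]/(x^2)\<close>

text \<open>
  Attaching leaves, in cyclic order after the first labelled leaf l, along its boundary cycle: a
  corner is denoted by its first half-edge, and \<open>corners G h l\<close> are the corners met on the way
  from the leaf h back to l.  After a new leaf is attached, the next one is attached on the way
  from there to l, where the corner just used now consists of a part before and a part after the
  new leaf.  The new leaves are appended to the orientation.
\<close>

definition corners :: "bwgraph \<Rightarrow> nat \<Rightarrow> nat \<Rightarrow> nat list" where
  "corners G h l = map (\<lambda>i. opp G ((bd_step G ^^ i) h))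
     [0..<(LEAST m. 0 < m \<and> (bd_step G ^^ m) h = l)]"

definition attach_leaf :: "bwgraph \<Rightarrow> nat \<Rightarrow> bwgraph" where
  "attach_leaf G k = (let l = fresh G in
     G\<lparr>hedges := insert l (hedges G),
       src := (src G)(l := src G k),
       opp := (opp G)(l := l),
       nxt := (nxt G)(k := l, l := nxt G k),
       labs := labs G @ [l],
       orient := orient G @ [l]\<rparr>)"

fun attach_leaves :: "nat \<Rightarrow> bwgraph \<Rightarrow> bwgraph list" where
  "attach_leaves 0 G = [G]"
| "attach_leaves (Suc m) G =
     concat (map (\<lambda>k. attach_leaves m (attach_leaf G k)) (corners G (last (labs G)) (hd (labs G))))"

text \<open>
  Cutting around the white vertex.  The white vertex w with half-edges h1,...,hk (from the start
  half-edge on) is oriented as w ^ h1 ^ ... ^ hk, and the remaining open graph \<open>\<Gamma>\<close>, if all its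
  vertices are trivalent, by the canonical orientation given by the product of the blocks
  v ^ a ^ b ^ c, one for each vertex v with half-edges a, b, c in cyclic order.  As these blocks
  and the cyclic permutations of a, b, c are even, no choice matters.  With the canonical
  orientation a trivalent graph represents the generator of H_0 given by its topological type.
\<close>

definition cut_orientation :: "bwgraph \<Rightarrow> nat list" where
  "cut_orientation G = white G # cyc G (start G) @
     concat (map (\<lambda>v. v # cyc G (Min (hedges_at G v))) (sorted_list_of_set (black G)))"

definition cut_sign :: "bwgraph \<Rightarrow> int" where
  "cut_sign G = list_sign (orient G) * list_sign (cut_orientation G)"

text \<open>
  A trivalent open graph acts on A by composing the structure maps of the Frobenius algebra along
  the graph: each vertex carries the trilinear form \<open>tri\<close>, (a,b,c) |-> counit(a b c), each edge
  the copairing nu(1), an input is fed into the half-edge which is the corresponding labelled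
  leaf, and an unlabelled start leaf produces the unit.  In coordinates this is the sum over all
  labellings of the half-edges by basis elements.  After cutting, the half-edges formerly at the
  white vertex are the outputs; an edge joining two of them is the copairing and a labelled leaf
  among them is an identity.
\<close>

definition tri :: "nat \<Rightarrow> nat \<Rightarrow> nat \<Rightarrow> 'r::comm_ring_1" where
  "tri a b c = (\<Sum>d<2. \<Sum>e<2. mult a b d * mult d c e * counit e)"

definition labellings :: "bwgraph \<Rightarrow> nat list \<Rightarrow> (nat \<Rightarrow> nat) set" where
  "labellings G u = {c \<in> hedges G \<rightarrow>\<^sub>E {0, 1}.
     map c (labs G) = u \<and> (unlabelled_start G \<longrightarrow> c (start G) = 0)}"

definition weight :: "bwgraph \<Rightarrow> (nat \<Rightarrow> nat) \<Rightarrow> 'r::comm_ring_1" where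
  "weight G c =
     (\<Prod>v\<in>black G. let h = Min (hedges_at G v) in
        tri (c h) (c (nxt G h)) (c (nxt G (nxt G h)))) *
     (\<Prod>h\<in>{h \<in> hedges G. h < opp G h}. comult 0 (c h) (c (opp G h)))"

text \<open>
  The operation of G after cutting around the white vertex, on a word u with one entry for each
  labelled leaf.  If a black vertex is not trivalent, the open graph has positive degree and hence
  is zero in H_0.
\<close>

definition cut_op :: "bwgraph \<Rightarrow> nat list \<Rightarrow> nat list \<Rightarrow>\<^sub>0 'r::comm_ring_1" where
  "cut_op G u =
     (if \<forall>v\<in>black G. card (hedges_at G v) = 3
      then (\<Sum>c\<in>labellings G u.
              scale (of_int (cut_sign G) * weight G c) (tens (map c (cyc G (start G)))))
      else 0)"

text \<open>
  The action of SD((1,0),(1,0)): on a diagram and a basis word of C_(j-1), j - 1 leaves are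
  attached.  This is extended linearly in both variables and then passes to the quotient group,
  the value on a class being the common value of its representatives.
\<close>

definition act_word :: "bwgraph \<Rightarrow> nat list \<Rightarrow> nat list \<Rightarrow>\<^sub>0 'r::comm_ring_1" where
  "act_word G u = (\<Sum>G'\<leftarrow>attach_leaves (length u - 1) G. cut_op G' u)"

definition act_chain :: "(bwgraph \<Rightarrow>\<^sub>0 int) \<Rightarrow> (nat list \<Rightarrow>\<^sub>0 'r) \<Rightarrow> nat list \<Rightarrow>\<^sub>0 'r::comm_ring_1" where
  "act_chain T c = (\<Sum>G\<in>Poly_Mapping.keys T.
     scale (of_int (Poly_Mapping.lookup T G)) (lin_ext (act_word G) c))"

definition sd_action ::
  "(bwgraph \<Rightarrow>\<^sub>0 int) set \<Rightarrow> (nat list \<Rightarrow>\<^sub>0 'r) \<Rightarrow> nat list \<Rightarrow>\<^sub>0 'r::comm_ring_1" where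
  "sd_action S c = the_elem ((\<lambda>T. act_chain T c) ` S)"

text \<open>The map into HH_q induced on homology classes by F(S (x) -).\<close>

definition hh_map ::
  "(bwgraph \<Rightarrow>\<^sub>0 int) set \<Rightarrow> nat \<Rightarrow> (nat list \<Rightarrow>\<^sub>0 'r) set \<Rightarrow> (nat list \<Rightarrow>\<^sub>0 'r::comm_ring_1) set" where
  "hh_map S q X = the_elem ((\<lambda>z. hh_class q (sd_action S z)) ` X)"


section \<open>The diagrams t_g\<close>

text \<open>
  A planar trivalent tree with a distinguished external leg (the root) is a planar binary tree.
\<close>

datatype btree = Leg | Fork btree btree

fun legs :: "btree \<Rightarrow> nat" where
  "legs Leg = 1"
| "legs (Fork l r) = legs l + legs r"

text \<open>
  \<open>tree_edges t p b hs\<close> are the edges of the graph in which the root of t is connected to the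
  half-edge p and its legs, from left to right, to the half-edges hs.  A fork uses four numbers
  b, b+1, b+2, b+3 for its vertex and its half-edges towards the root, the left and the right
  subtree; the subtrees use the numbers after these.
\<close>

fun tree_edges :: "btree \<Rightarrow> nat \<Rightarrow> nat \<Rightarrow> nat list \<Rightarrow> (nat \<times> nat) list" where
  "tree_edges Leg p b hs = [(p, hd hs)]"
| "tree_edges (Fork l r) p b hs = (p, b + 1) #
     tree_edges l (b + 2) (b + 4) (take (legs l) hs) @
     tree_edges r (b + 3) (b + 4 * legs l) (drop (legs l) hs)"

text \<open>
  The white vertex is 0 and h_i is the number i, for i = 1,...,2g+2.  The first tree, with g legs
  besides the root, has its root at h_1 and its legs at h_(2g+1),...,h_5,h_3; the order is reversed
  since walking around the white vertex and around the tree gives opposite orders in a planar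
  graph.  The second tree, with g + 1 legs besides the root, has the incoming leaf as its root
  (the fixed point b2 + 1 of \<open>opp\<close>) and its legs at h_(2g+2),...,h_4,h_2, so that the incoming
  leaf lies between the branches of h_2 and h_(2g+2).  The cyclic ordering at a black vertex is
  root, left, right.  The orientation is the one for which \<open>cut_sign\<close> is positive.
\<close>

definition t_graph :: "btree \<Rightarrow> btree \<Rightarrow> bwgraph" where
  "t_graph T1 T2 =
     (let g = legs T1; k = 2 * g + 2; b1 = k + 1; b2 = b1 + 4 * (g - 1);
          V = insert 0 {b1 + 4 * i | i. i < 2 * g - 1};
          E = tree_edges T1 1 b1 (map (\<lambda>i. 2 * i + 1) (rev [1..<g + 1])) @
              tree_edges T2 (b2 + 1) b2 (map (\<lambda>i. 2 * i) (rev [1..<g + 2]))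
      in \<lparr> verts = V,
           hedges = {0..<10 * g - 1} - V,
           src = (\<lambda>h. if h \<le> k then 0 else h - (h - b1) mod 4),
           opp = (\<lambda>h. the (map_of (E @ map prod.swap E) h)),
           nxt = (\<lambda>h. if h \<le> k then (if h = k then 1 else h + 1)
                       else if (h - b1) mod 4 = 3 then h - 2 else h + 1),
           white = 0,
           start = 1,
           labs = [b2 + 1],
           orient = [0..<10 * g - 1] \<rparr>)"

definition t_diagram :: "btree \<Rightarrow> btree \<Rightarrow> (bwgraph \<Rightarrow>\<^sub>0 int) set" where
  "t_diagram T1 T2 = sd_class 1 (Poly_Mapping.single (t_graph T1 T2) 1)"

end

theory Submission
  imports Defs "HOL-Library.Multiset"
begin

text \<open>
  The value of the action on the class of a diagram and on a chain of degree 0 is a finite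
  computation, once it is known that it does not depend on the representative of the class.

  Independence of the representative.  On chains of degree 0 no leaf is attached, so a diagram acts
  by \<open>cut_op\<close>.  In the basis 1, x the trilinear form of A is 1 if exactly one of the three arguments
  is x and 0 otherwise, and the copairing is 1 if exactly one of its two factors is x.  Hence
  \<open>cut_op\<close> is a sign times the sum of the output words of all balanced labellings, in which exactly
  one half-edge at each black vertex and exactly one half of each edge carries x (\<open>cut_op_eq\<close>).  This
  condition makes sense for every valence, and it is preserved by blow-ups, since the labels of the
  new edge are determined by the others.  The sign is insensitive to the choices in its
  definition because a trivalent vertex together with its half-edges is a block of even length whose
  three half-edges may be rotated; this settles isomorphisms and changes of orientation
  (\<open>bw_iso_cut_op\<close>, \<open>orient_cut_op\<close>).  In the boundary of a graph with a black vertex of valence at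
  least 4, a blow-up can be trivalent only if it splits a single vertex of valence 4 into two
  trivalent ones.  There are two such blow-ups; they have the same balanced labellings, and their
  signs are opposite because a cyclic rotation of four half-edges is odd
  (\<open>cut_op_opposite_blow_ups\<close>).  So all relations act as zero (\<open>act_chain_sd_rel\<close>).

  The value.  In the reduced complex a word vanishes unless all its entries after the first are x.
  So all half-edges at the white vertex but the start half-edge carry x.  Labels change along every
  edge, and a fork both of whose upper half-edges carry 1 has x on its lower one; climbing down
  the two trees from their legs, all labels are forced.  The start half-edge gets 1 and the incoming leaf
  gets x, whence the value is 1 (x) x (x) ... (x) x on the input x and zero on the input 1
  (\<open>cut_op_t_graph\<close>).

  Homology.  In the reduced complex of A the faces of x^a (x) x (x) ... (x) x in which two factors x
  meet are zero, so with m factors x the differential is 1 + (-1)^m times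
  x^(a+1) (x) x (x) ... (x) x.  Thus 1 (x) x (x) ... (x) x is a cycle for odd m, and it does not
  occur in any boundary, as all words there begin with x.  Everything holds over every commutative
  ring in which 1 is not 0.
\<close>

section \<open>Signs of rearrangements\<close>

text \<open>
  Orientations are compared by counting adjacent transpositions.  Recording the parity of a
  rearrangement as a relation, instead of as the sign of a permutation of positions, allows
  rearrangements to be composed, put into a context and mapped along a relabelling of the entries.
\<close>

inductive rearr :: "int \<Rightarrow> 'a list \<Rightarrow> 'a list \<Rightarrow> bool" where
  unchanged: "rearr 1 xs xs"
| one_swap: "rearr s xs (as @ x # y # bs) \<Longrightarrow> rearr (- s) xs (as @ y # x # bs)"

lemma rearr_trans:
  assumes "rearr t ys zs" "rearr s xs ys"
  shows "rearr (s * t) xs zs"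
  using assms
proof (induction)
  case (unchanged ys) then show ?case by simp
next
  case (one_swap t ys as x y bs)
  then show ?case using rearr.one_swap[of "s * t" xs as x y bs] by simp
qed

lemma rearr_context: "rearr s xs ys \<Longrightarrow> rearr s (as @ xs @ bs) (as @ ys @ bs)"
proof (induction rule: rearr.induct)
  case (one_swap s xs cs x y ds)
  then show ?case using rearr.one_swap[of s "as @ xs @ bs" "as @ cs" x y "ds @ bs"] by simp
qed (rule rearr.unchanged)

lemma rearr_append:
  assumes "rearr s xs ys" "rearr t us vs"
  shows "rearr (s * t) (xs @ us) (ys @ vs)"
proof -
  have "rearr s (xs @ us) (ys @ us)" using rearr_context[OF assms(1), of "[]" us] by simp
  moreover have "rearr t (ys @ us) (ys @ vs)" using rearr_context[OF assms(2), of ys "[]"] by simp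
  ultimately show ?thesis by (rule rearr_trans[rotated])
qed

lemma rearr_Cons: "rearr s xs ys \<Longrightarrow> rearr s (x # xs) (x # ys)"
  using rearr_context[of s xs ys "[x]" "[]"] by simp

lemma rearr_map: "rearr s xs ys \<Longrightarrow> rearr s (map f xs) (map f ys)"
proof (induction rule: rearr.induct)
  case (one_swap s xs as x y bs)
  then show ?case using rearr.one_swap[of s "map f xs" "map f as" "f x" "f y" "map f bs"] by simp
qed (rule rearr.unchanged)

lemma rearr_mset: "rearr s xs ys \<Longrightarrow> mset xs = mset ys"
  by (induction rule: rearr.induct) auto

lemma rearr_Cons_append: "rearr ((- 1) ^ length ys) (x # ys) (ys @ [x])"
proof (induction ys rule: rev_induct)
  case Nil show ?case by (simp add: rearr.unchanged)
next
  case (snoc y ys)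
  have "rearr ((- 1) ^ length ys) (x # ys @ [y]) (ys @ x # y # [])"
    using rearr_context[OF snoc, of "[]" "[y]"] by simp
  from rearr.one_swap[OF this] show ?case by simp
qed

lemma rearr_swap_blocks: "rearr ((- 1) ^ (length xs * length ys)) (xs @ ys) (ys @ xs)"
proof (induction xs)
  case Nil show ?case by (simp add: rearr.unchanged)
next
  case (Cons x xs)
  have "rearr ((- 1) ^ (length xs * length ys)) (x # xs @ ys) (x # ys @ xs)"
    using Cons by (rule rearr_Cons)
  moreover have "rearr ((- 1) ^ length ys) (x # ys @ xs) (ys @ x # xs)"
    using rearr_context[OF rearr_Cons_append[of ys x], of "[]" xs] by simp
  ultimately have "rearr ((- 1) ^ (length xs * length ys) * (- 1) ^ length ys) (x # xs @ ys) (ys @ x # xs)"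
    by (metis rearr_trans)
  then show ?case by (simp add: power_add mult.commute)
qed

lemma rearr_exists:
  assumes "mset xs = mset ys"
  obtains s where "rearr s xs ys"
proof -
  have "\<exists>s. rearr s xs ys"
    using assms
  proof (induction xs arbitrary: ys)
    case Nil then show ?case by (auto intro: rearr.unchanged)
  next
    case (Cons x xs)
    then have "x \<in> set ys" by (metis list.set_intros(1) set_mset_mset)
    then obtain us vs where ys: "ys = us @ x # vs" by (meson split_list)
    with Cons.prems have "mset xs = mset (us @ vs)" by simp
    with Cons.IH obtain s where "rearr s xs (us @ vs)" by blast
    from rearr_Cons[OF this, of x] have "rearr s (x # xs) (x # us @ vs)" .
    moreover have "rearr ((- 1) ^ length us) (x # us @ vs) ys"
      using rearr_context[OF rearr_Cons_append[of us x], of "[]" vs] by (simp add: ys)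
    ultimately show ?case by (metis rearr_trans)
  qed
  with that show ?thesis by blast
qed

lemma rearr_concat:
  assumes "\<And>v. v \<in> set vs \<Longrightarrow> rearr 1 (b v) (b' v)"
  shows "rearr 1 (concat (map b vs)) (concat (map b' vs))"
  using assms
proof (induction vs)
  case Nil show ?case by (simp add: rearr.unchanged)
next
  case (Cons v vs)
  then show ?case using rearr_append[of 1 "b v" "b' v" 1] by simp
qed

text \<open>
  Transposing two blocks of entries costs the product of their lengths, so blocks of even length
  can be permuted freely.
\<close>

lemma rearr_even_blocks:
  assumes "rearr s vs ws" "\<And>v. v \<in> set vs \<Longrightarrow> even (length (b v))"
  shows "rearr 1 (concat (map b vs)) (concat (map b ws))"
  using assms
proof (induction)
  case (unchanged xs) show ?case by (rule rearr.unchanged)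
next
  case (one_swap s xs as x y bs)
  have "set xs = set (as @ x # y # bs)"
    using rearr_mset[OF one_swap.hyps] by (metis set_mset_mset)
  then have "even (length (b x))"
    using one_swap.prems by simp
  then have "rearr 1 (b x @ b y) (b y @ b x)"
    using rearr_swap_blocks[of "b x" "b y"] by simp
  from rearr_context[OF this, of "concat (map b as)" "concat (map b bs)"] one_swap.IH one_swap.prems
  show ?case using rearr_trans by fastforce
qed

lemma list_sign_square: "list_sign xs * list_sign xs = 1"
proof (induction xs)
  case (Cons x xs)
  have "list_sign (x # xs) * list_sign (x # xs) = ((- 1) ^ length (filter (\<lambda>y. y < x) xs) * 
    (- 1) ^ length (filter (\<lambda>y. y < x) xs)) * (list_sign xs * list_sign xs)"
    by (simp add: algebra_simps)
  then show ?case using Cons by (simp add: power_add[symmetric])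
qed simp

lemma list_sign_adjacent:
  "x \<noteq> y \<Longrightarrow> list_sign (as @ y # x # bs) = - list_sign (as @ x # y # bs)"
  by (induction as) auto

text \<open>
  This links the relation to the sign used in the definition of the action: a single adjacent
  transposition changes exactly one of the comparisons counted by \<open>list_sign\<close>.
\<close>

lemma list_sign_rearr: "rearr s xs ys \<Longrightarrow> distinct xs \<Longrightarrow> list_sign ys = s * list_sign xs"
proof (induction rule: rearr.induct)
  case (one_swap s xs as x y bs)
  have "distinct (as @ x # y # bs)"
    using rearr_mset[OF one_swap.hyps] one_swap.prems by (metis mset_eq_imp_distinct_iff)
  then show ?case using list_sign_adjacent[of x y as bs] one_swap by simp
qed simp

text \<open>
  The sign of a list depends on the numbers in it, but the product of the signs of two orderings of
  the same set is the parity of the rearrangement between them, which survives any injective renaming.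
\<close>

lemma relative_sign_map:
  assumes "mset xs = mset ys" "distinct xs" "inj_on f (set xs)"
  shows "list_sign (map f xs) * list_sign (map f ys) = list_sign xs * list_sign ys"
proof -
  obtain s where s: "rearr s xs ys" using rearr_exists[OF assms(1)] .
  have "list_sign ys = s * list_sign xs"
    using list_sign_rearr[OF s assms(2)] .
  moreover have "list_sign (map f ys) = s * list_sign (map f xs)"
    using list_sign_rearr[OF rearr_map[OF s]] assms by (simp add: distinct_map)
  ultimately show ?thesis
    by (simp add: mult.left_commute list_sign_square)
qed

section \<open>Linear extension\<close>

lemma lookup_scale [simp]: "Poly_Mapping.lookup (scale r p) k = r * Poly_Mapping.lookup p k"
  by (auto simp: scale_def map.rep_eq when_def)

lemma scale_add_left: "scale (r + s) p = scale r p + scale s p"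
  by (rule poly_mapping_eqI) (simp add: lookup_add algebra_simps)

lemma scale_scale [simp]: "scale r (scale s p) = scale (r * s) p"
  by (rule poly_mapping_eqI) (simp add: algebra_simps)

lemma scale_1 [simp]: "scale 1 p = p"
  by (rule poly_mapping_eqI) simp

lemma scale_0 [simp]: "scale 0 p = 0" "scale r 0 = 0"
  by (rule poly_mapping_eqI, simp)+

lemma scale_minus_left: "scale (- r) p = - scale r p"
  by (rule poly_mapping_eqI) simp

lemma scale_minus_right: "scale r (- p) = - scale r p"
  by (rule poly_mapping_eqI) simp

lemma scale_sum: "scale r (sum f A) = (\<Sum>x\<in>A. scale r (f x))"
  by (rule poly_mapping_eqI) (simp add: lookup_sum sum_distrib_left)

lemma lin_ext_superset:
  assumes "finite S" "Poly_Mapping.keys c \<subseteq> S"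
  shows "lin_ext f c = (\<Sum>w\<in>S. scale (Poly_Mapping.lookup c w) (f w))"
  unfolding lin_ext_def using assms
  by (intro sum.mono_neutral_left) (auto simp: in_keys_iff)

lemma act_chain_superset:
  assumes "finite S" "Poly_Mapping.keys T \<subseteq> S"
  shows "act_chain T c = (\<Sum>G\<in>S. scale (of_int (Poly_Mapping.lookup T G)) (lin_ext (act_word G) c))"
  unfolding act_chain_def using assms
  by (intro sum.mono_neutral_left) (auto simp: in_keys_iff)

lemma act_chain_zero [simp]: "act_chain 0 c = 0"
  by (simp add: act_chain_def)

lemma act_chain_single: "act_chain (Poly_Mapping.single G r) c = scale (of_int r) (lin_ext (act_word G) c)"
  by (subst act_chain_superset[of "{G}"]) auto

lemma act_chain_add: "act_chain (S + T) c = act_chain S c + act_chain T c"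
proof -
  let ?K = "Poly_Mapping.keys S \<union> Poly_Mapping.keys T"
  have "Poly_Mapping.keys (S + T) \<subseteq> ?K" by (rule Poly_Mapping.keys_add)
  then show ?thesis
    by (simp add: act_chain_superset[of ?K] lookup_add scale_add_left sum.distrib)
qed

lemma act_chain_diff: "act_chain (S - T) c = act_chain S c - act_chain T c"
  using act_chain_add[of "S - T" T c] by simp

lemma act_chain_sum: "act_chain (sum f A) c = (\<Sum>x\<in>A. act_chain (f x) c)"
  by (induction A rule: infinite_finite_induct) (simp_all add: act_chain_add)

section \<open>Vertices as cyclically ordered sets of half-edges\<close>

text \<open>
  A finite fat graph with a white vertex and a start half-edge: the conditions on which the
  evaluation of the open graph rests, and which a blow-up of a vertex of valence four preserves.
\<close>

definition ribbon :: "bwgraph \<Rightarrow> bool" where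
  "ribbon G \<longleftrightarrow>
     finite (verts G) \<and> finite (hedges G) \<and> verts G \<inter> hedges G = {} \<and>
     white G \<in> verts G \<and> start G \<in> hedges_at G (white G) \<and>
     (\<forall>h\<in>hedges G. src G h \<in> verts G \<and>
        opp G h \<in> hedges G \<and> opp G (opp G h) = h \<and>
        nxt G h \<in> hedges G \<and> distinct (cyc G h) \<and> set (cyc G h) = hedges_at G (src G h) \<and>
        nxt G (last (cyc G h)) = h)"

lemma ribbon_if_bw_graph: "bw_graph n G \<Longrightarrow> ribbon G"
  by (auto simp: bw_graph_def ribbon_def)

lemma length_cyc [simp]: "length (cyc G h) = card (hedges_at G (src G h))"
  by (simp add: cyc_def)

lemma nth_cyc: "i < card (hedges_at G (src G h)) \<Longrightarrow> cyc G h ! i = (nxt G ^^ i) h"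
  by (simp add: cyc_def)

lemma hedges_atD: "h \<in> hedges_at G v \<Longrightarrow> h \<in> hedges G \<and> src G h = v"
  by (simp add: hedges_at_def)

lemma finite_hedges_at: "ribbon G \<Longrightarrow> finite (hedges_at G v)"
  by (simp add: hedges_at_def ribbon_def)

lemma valence_pos: "ribbon G \<Longrightarrow> h \<in> hedges G \<Longrightarrow> 0 < card (hedges_at G (src G h))"
  using finite_hedges_at[of G "src G h"] by (auto simp: card_gt_0_iff hedges_at_def)

lemma nxt_in_hedges_at:
  assumes "ribbon G" "h \<in> hedges_at G v"
  shows "nxt G h \<in> hedges_at G v"
proof -
  let ?n = "card (hedges_at G (src G h))"
  have h: "h \<in> hedges G" "src G h = v" using assms by (auto simp: hedges_at_def)
  have r: "set (cyc G h) = hedges_at G v" "nxt G (last (cyc G h)) = h"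
    using assms h by (auto simp: ribbon_def)
  have "?n > 0" using assms(1) h(1) by (rule valence_pos)
  show ?thesis
  proof (cases "?n = 1")
    case True
    then have "cyc G h = [h]" by (simp add: cyc_def)
    with r assms(2) show ?thesis by simp
  next
    case False
    with \<open>?n > 0\<close> have "1 < length (cyc G h)" by simp
    then have "cyc G h ! 1 \<in> set (cyc G h)" by (rule nth_mem)
    moreover have "cyc G h ! 1 = nxt G h"
      using nth_cyc[of 1 G h] \<open>1 < length (cyc G h)\<close> by simp
    ultimately have "nxt G h \<in> set (cyc G h)" by simp
    with r show ?thesis by simp
  qed
qed

lemma funpow_nxt_in_hedges_at:
  "ribbon G \<Longrightarrow> h \<in> hedges_at G v \<Longrightarrow> (nxt G ^^ i) h \<in> hedges_at G v"
  by (induction i) (auto simp: nxt_in_hedges_at)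

lemma funpow_nxt_valence:
  assumes "ribbon G" "h \<in> hedges G"
  shows "(nxt G ^^ card (hedges_at G (src G h))) h = h"
proof -
  let ?n = "card (hedges_at G (src G h))"
  have "?n > 0" using assms by (rule valence_pos)
  then have "cyc G h \<noteq> []" by (metis length_cyc length_greater_0_conv)
  then have "last (cyc G h) = cyc G h ! (?n - 1)"
    by (simp add: last_conv_nth)
  also have "\<dots> = (nxt G ^^ (?n - 1)) h"
    using \<open>?n > 0\<close> by (simp add: nth_cyc)
  finally have "last (cyc G h) = (nxt G ^^ (?n - 1)) h" .
  moreover have "nxt G (last (cyc G h)) = h"
    using assms by (simp add: ribbon_def)
  ultimately have "nxt G ((nxt G ^^ (?n - 1)) h) = h" by metis
  then show ?thesis using \<open>?n > 0\<close> by (metis Suc_pred' funpow.simps(2) o_apply)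
qed

text \<open>
  Starting the enumeration of the half-edges at a vertex at another half-edge rotates it, because
  the successor map returns to its starting point after as many steps as the vertex has half-edges.
\<close>

lemma cyc_rotate:
  assumes G: "ribbon G" and h: "h \<in> hedges_at G v" and h': "h' \<in> hedges_at G v"
  obtains k where "cyc G h' = rotate k (cyc G h)"
proof -
  let ?n = "card (hedges_at G v)"
  have s: "src G h = v" "h \<in> hedges G" "src G h' = v" using h h' by (auto simp: hedges_at_def)
  have "?n > 0" using valence_pos[OF G] s by blast
  have "h' \<in> set (cyc G h)" using G h' s by (auto simp: ribbon_def)
  then obtain k where k: "h' = (nxt G ^^ k) h" by (auto simp: cyc_def)
  have per: "(nxt G ^^ (j mod ?n)) h = (nxt G ^^ j) h" for j
    using funpow_mod_eq[of ?n "nxt G" h j] funpow_nxt_valence[OF G s(2)] s by simp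
  have "cyc G h' = rotate k (cyc G h)"
  proof (rule nth_equalityI)
    fix i assume "i < length (cyc G h')"
    then have i: "i < ?n" by (simp add: s)
    then have "cyc G h' ! i = (nxt G ^^ (i + k)) h"
      using nth_cyc[of i G h'] by (simp add: s) (simp add: k funpow_add)
    also have "\<dots> = (nxt G ^^ ((k + i) mod ?n)) h"
      by (simp add: per add.commute)
    also have "\<dots> = cyc G h ! ((k + i) mod ?n)"
      using \<open>?n > 0\<close> by (simp add: nth_cyc s)
    also have "\<dots> = rotate k (cyc G h) ! i"
      using i by (simp add: nth_rotate s)
    finally show "cyc G h' ! i = rotate k (cyc G h) ! i" .
  qed (simp add: s)
  with that show ?thesis .
qed

lemma rearr_rotate: "odd (length xs) \<Longrightarrow> rearr 1 xs (rotate k xs)"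
proof (induction k)
  case 0 show ?case by (simp add: rearr.unchanged)
next
  case (Suc k)
  obtain y ys where ys: "rotate k xs = y # ys"
    using Suc.prems by (cases "rotate k xs") auto
  then have "even (length ys)" using Suc.prems by (metis length_rotate length_Cons even_Suc)
  then have "rearr 1 (rotate k xs) (rotate (Suc k) xs)"
    using rearr_Cons_append[of ys y] by (simp add: ys)
  from rearr_trans[OF this Suc.IH[OF Suc.prems]] show ?case by simp
qed

text \<open>
  For a vertex of odd valence a rotation is an even permutation.  So the block of a trivalent vertex in
  the canonical orientation may start with any of its half-edges.
\<close>

lemma rearr_cyc:
  assumes "ribbon G" "h \<in> hedges_at G v" "h' \<in> hedges_at G v" "odd (card (hedges_at G v))"
  shows "rearr 1 (cyc G h) (cyc G h')"
proof -
  obtain k where k: "cyc G h' = rotate k (cyc G h)"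
    using cyc_rotate[OF assms(1-3)] .
  have "odd (length (cyc G h))" using assms by (auto simp: hedges_at_def)
  then show ?thesis unfolding k by (rule rearr_rotate)
qed

definition trivalent :: "bwgraph \<Rightarrow> bool" where
  "trivalent G \<longleftrightarrow> (\<forall>v\<in>black G. card (hedges_at G v) = 3)"

lemma trivalent_hedges_at:
  assumes "ribbon G" "h \<in> hedges_at G v" "card (hedges_at G v) = 3"
  shows "cyc G h = [h, nxt G h, nxt G (nxt G h)]"
    and "hedges_at G v = {h, nxt G h, nxt G (nxt G h)}"
    and "distinct [h, nxt G h, nxt G (nxt G h)]"
proof -
  have s: "h \<in> hedges G" "src G h = v" using assms(2) by (auto simp: hedges_at_def)
  show c: "cyc G h = [h, nxt G h, nxt G (nxt G h)]"
    by (simp add: cyc_def s assms(3) numeral_3_eq_3)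
  have "distinct (cyc G h)" "set (cyc G h) = hedges_at G v"
    using assms(1) s by (auto simp: ribbon_def)
  then show "hedges_at G v = {h, nxt G h, nxt G (nxt G h)}"
    and "distinct [h, nxt G h, nxt G (nxt G h)]"
    unfolding c by auto
qed

section \<open>Operations as sums over balanced labellings\<close>

text \<open>
  The labels are exponents of x.  At a trivalent vertex the condition says that counit(abc) is 1, on an
  edge it says that the coefficient of the copairing is 1.  It is stated as a sum over all half-edges of a
  vertex so that it needs no choice of a first half-edge and applies to every valence.
\<close>

definition balanced :: "bwgraph \<Rightarrow> (nat \<Rightarrow> nat) \<Rightarrow> bool" where
  "balanced G c \<longleftrightarrow> (\<forall>v\<in>black G. (\<Sum>h\<in>hedges_at G v. c h) = 1) \<and>
     (\<forall>h\<in>hedges G. opp G h \<noteq> h \<longrightarrow> c h + c (opp G h) = 1)"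

lemma tri_eq:
  assumes "a \<le> 1" "b \<le> 1" "c \<le> 1"
  shows "tri a b c = (of_bool (a + b + c = 1) :: 'r::comm_ring_1)"
  using assms by (auto simp: tri_def Defs.mult_def counit_def numeral_2_eq_2 le_Suc_eq)

lemma comult_0_eq:
  assumes "a \<le> 1" "b \<le> 1"
  shows "comult 0 a b = (of_bool (a + b = 1) :: 'r::comm_ring_1)"
  using assms by (auto simp: comult_def le_Suc_eq)

lemma prod_of_bool:
  "finite A \<Longrightarrow> (\<Prod>x\<in>A. of_bool (P x)) = (of_bool (\<forall>x\<in>A. P x) :: 'r::comm_ring_1)"
  by (induction A rule: finite_induct) auto

text \<open>
  The structure constants involved are 0 or 1, so the weight is the indicator of a condition.  An edge enters
  the weight through its smaller half-edge only, but the condition on it is symmetric.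
\<close>

lemma weight_eq:
  assumes G: "ribbon G" and t: "trivalent G" and c: "c \<in> hedges G \<rightarrow> {0, 1}"
  shows "weight G c = (of_bool (balanced G c) :: 'r::comm_ring_1)"
proof -
  have le: "c h \<le> 1" if "h \<in> hedges G" for h
    using c that by (auto simp: Pi_iff)
  have fin: "finite (black G)" "finite {h \<in> hedges G. h < opp G h}"
    using G by (auto simp: ribbon_def black_def)
  have v: "tri (c h) (c (nxt G h)) (c (nxt G (nxt G h))) =
      (of_bool ((\<Sum>h\<in>hedges_at G v. c h) = 1) :: 'r)"
    if "v \<in> black G" "h = Min (hedges_at G v)" for h v
  proof -
    have 3: "card (hedges_at G v) = 3" using t that by (simp add: trivalent_def)
    then have "hedges_at G v \<noteq> {}" by auto
    then have "h \<in> hedges_at G v"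
      unfolding that using finite_hedges_at[OF G] by (intro Min_in)
    note h = trivalent_hedges_at[OF G this 3]
    have "{h, nxt G h, nxt G (nxt G h)} \<subseteq> hedges G"
      using h(2) by (auto simp: hedges_at_def)
    then have "c h \<le> 1" "c (nxt G h) \<le> 1" "c (nxt G (nxt G h)) \<le> 1"
      by (auto simp only: insert_subset intro: le)
    moreover have "(\<Sum>h\<in>hedges_at G v. c h) = c h + c (nxt G h) + c (nxt G (nxt G h))"
      unfolding h(2) using h(3) by simp
    ultimately show ?thesis by (simp only: tri_eq)
  qed
  have "(\<Prod>v\<in>black G. let h = Min (hedges_at G v) in
        tri (c h) (c (nxt G h)) (c (nxt G (nxt G h)))) =
      (\<Prod>v\<in>black G. of_bool ((\<Sum>h\<in>hedges_at G v. c h) = 1) :: 'r)"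
    by (rule prod.cong) (simp_all add: v Let_def)
  moreover have "(\<Prod>h\<in>{h \<in> hedges G. h < opp G h}. comult 0 (c h) (c (opp G h))) =
      (\<Prod>h\<in>{h \<in> hedges G. h < opp G h}. of_bool (c h + c (opp G h) = 1) :: 'r)"
    using G by (intro prod.cong comult_0_eq le) (auto simp: ribbon_def)
  moreover have "(\<forall>h\<in>{h \<in> hedges G. h < opp G h}. c h + c (opp G h) = 1) \<longleftrightarrow>
      (\<forall>h\<in>hedges G. opp G h \<noteq> h \<longrightarrow> c h + c (opp G h) = 1)" (is "?L \<longleftrightarrow> ?R")
  proof
    assume L: ?L
    show ?R
    proof (intro ballI impI)
      fix h assume h: "h \<in> hedges G" "opp G h \<noteq> h"
      then have "opp G h \<in> hedges G" "opp G (opp G h) = h" using G by (auto simp: ribbon_def)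
      then show "c h + c (opp G h) = 1"
        using L h by (cases "h < opp G h") (force simp: add.commute)+
    qed
  qed auto
  ultimately show ?thesis
    unfolding weight_def balanced_def by (simp add: prod_of_bool fin del: of_bool_eq_1_iff flip: of_bool_conj)
qed

definition states :: "bwgraph \<Rightarrow> nat list \<Rightarrow> (nat \<Rightarrow> nat) set" where
  "states G u = {c \<in> labellings G u. balanced G c}"

text \<open>
  The operation of the open graph up to sign; if some black vertices have higher valence, that of any of
  the trivalent graphs obtained by blowing them up.
\<close>

definition state_sum :: "bwgraph \<Rightarrow> nat list \<Rightarrow> nat list \<Rightarrow>\<^sub>0 'r::comm_ring_1" where
  "state_sum G u = (\<Sum>c\<in>states G u. tens (map c (cyc G (start G))))"

lemma finite_labellings: "ribbon G \<Longrightarrow> finite (labellings G u)"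
  unfolding labellings_def ribbon_def
  by (rule finite_subset[of _ "hedges G \<rightarrow>\<^sub>E {0, 1}"]) (auto intro: finite_PiE)

lemma cut_op_eq:
  assumes "ribbon G"
  shows "cut_op G u = (if trivalent G then scale (of_int (cut_sign G)) (state_sum G u)
    else (0 :: nat list \<Rightarrow>\<^sub>0 'r::comm_ring_1))"
proof (cases "trivalent G")
  case True
  have w: "weight G c = (of_bool (balanced G c) :: 'r)" if "c \<in> labellings G u" for c
    using that by (intro weight_eq assms True) (auto simp: labellings_def PiE_def)
  have "cut_op G u = (\<Sum>c\<in>labellings G u.
      scale (of_int (cut_sign G) * weight G c :: 'r) (tens (map c (cyc G (start G)))))"
    using True by (simp add: cut_op_def trivalent_def)
  also have "\<dots> = (\<Sum>c\<in>states G u. scale (of_int (cut_sign G)) (tens (map c (cyc G (start G)))))"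
    unfolding states_def using finite_labellings[OF assms]
    by (intro sum.mono_neutral_cong_right) (auto simp: w)
  finally show ?thesis using True by (simp add: state_sum_def scale_sum)
next
  case False
  then show ?thesis by (auto simp: cut_op_def trivalent_def)
qed

text \<open>
  Every half-edge belongs to exactly one vertex.  So the canonical orientation orders the same set as the
  given one, and the two can be compared.
\<close>

lemma cut_orientation_distinct:
  assumes G: "ribbon G" and t: "\<And>v. v \<in> black G \<Longrightarrow> hedges_at G v \<noteq> {}"
  shows "distinct (cut_orientation G)" "set (cut_orientation G) = verts G \<union> hedges G"
proof -
  let ?b = "\<lambda>v. v # cyc G (Min (hedges_at G v))"
  have fin: "finite (black G)" using G by (simp add: ribbon_def black_def)
  have cyc: "set (cyc G h) = hedges_at G v" "distinct (cyc G h)" if "h \<in> hedges_at G v" for h v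
    using G that by (auto simp: ribbon_def hedges_at_def)
  have Min: "Min (hedges_at G v) \<in> hedges_at G v" if "v \<in> black G" for v
    using finite_hedges_at[OF G] t that by (intro Min_in)
  have b: "set (?b v) = insert v (hedges_at G v)" if "v \<in> black G" for v
    using cyc(1)[OF Min[OF that]] by simp
  have white: "set (cyc G (start G)) = hedges_at G (white G)" "distinct (cyc G (start G))"
    using cyc G by (auto simp: ribbon_def)
  have dis: "v \<notin> hedges_at G w" if "v \<in> verts G" for v w
    using G that by (auto simp: ribbon_def hedges_at_def)
  have dis2: "hedges_at G v \<inter> hedges_at G w = {}" if "v \<noteq> w" for v w
    using that by (auto simp: hedges_at_def)
  have verts: "verts G = insert (white G) (black G)" "white G \<notin> black G"
    using G by (auto simp: black_def ribbon_def)
  have "hedges G = (\<Union>v\<in>verts G. hedges_at G v)"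
    using G by (auto simp: ribbon_def hedges_at_def)
  then show "set (cut_orientation G) = verts G \<union> hedges G"
    using fin b by (auto simp: cut_orientation_def white verts)
  have disj: "set (?b v) \<inter> set (?b w) = {}" if "v \<in> black G" "w \<in> black G" "v \<noteq> w" for v w
    unfolding b[OF that(1)] b[OF that(2)] using that dis dis2 by (simp add: verts Int_commute)
  have "distinct (concat (map ?b vs))" if "set vs \<subseteq> black G" "distinct vs" for vs
    using that
  proof (induction vs)
    case (Cons v vs)
    have "set (?b v) \<inter> set (concat (map ?b vs)) = {}"
    proof -
      have "set (?b v) \<inter> set (?b w) = {}" if "w \<in> set vs" for w
        using Cons.prems that by (intro disj) auto
      then show ?thesis unfolding set_concat set_map by blast
    qed
    moreover have "v \<in> black G" using Cons.prems by simp
    then have "distinct (?b v)"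
      using cyc[OF Min] dis by (simp add: verts)
    ultimately show ?case using Cons by auto
  qed simp
  from this[of "sorted_list_of_set (black G)"]
  have "distinct (concat (map ?b (sorted_list_of_set (black G))))"
    using fin by simp
  moreover have "set (concat (map ?b (sorted_list_of_set (black G)))) = (\<Union>v\<in>black G. insert v (hedges_at G v))"
    using fin b by auto
  moreover have "white G \<notin> hedges_at G (white G)" "white G \<notin> (\<Union>v\<in>black G. insert v (hedges_at G v))"
    using dis by (auto simp: verts)
  moreover have "hedges_at G (white G) \<inter> insert v (hedges_at G v) = {}" if "v \<in> black G" for v
    using dis[of v "white G"] dis2[of "white G" v] that verts by blast
  ultimately show "distinct (cut_orientation G)"
    unfolding cut_orientation_def distinct.simps distinct_append set_append white(1)
    using white(2) by blast
qed

section \<open>Isomorphic and reoriented graphs\<close>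

lemma funpow_iso:
  assumes "ribbon G" "\<And>h. h \<in> hedges G \<Longrightarrow> n' (f h) = f (nxt G h)" "h \<in> hedges G"
  shows "(n' ^^ i) (f h) = f ((nxt G ^^ i) h)"
proof (induction i)
  case (Suc i)
  have "(nxt G ^^ i) h \<in> hedges G"
    using funpow_nxt_in_hedges_at[OF assms(1), of h "src G h" i] assms(3) by (auto simp: hedges_at_def)
  then show ?case using Suc assms(2) by simp
qed simp

text \<open>
  An isomorphism transports balanced labellings and the cyclic order at the white vertex.  The sign
  needs care, since the canonical orientation lists black vertices in increasing order and
  begins each block with the least half-edge, and neither is preserved by an isomorphism.  Both
  effects are even.
\<close>

lemma bw_iso_cut_op:
  assumes bw: "bw_graph n G" and iso: "bw_iso G G'"
  shows "cut_op G' u = (cut_op G u :: nat list \<Rightarrow>\<^sub>0 'r::comm_ring_1)"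
proof -
  have G: "ribbon G" using bw by (rule ribbon_if_bw_graph)
  obtain f where inj: "inj_on f (verts G \<union> hedges G)"
    and V: "verts G' = f ` verts G" and H: "hedges G' = f ` hedges G"
    and src: "\<And>h. h \<in> hedges G \<Longrightarrow> src G' (f h) = f (src G h)"
    and opp: "\<And>h. h \<in> hedges G \<Longrightarrow> opp G' (f h) = f (opp G h)"
    and nxt: "\<And>h. h \<in> hedges G \<Longrightarrow> nxt G' (f h) = f (nxt G h)"
    and white: "white G' = f (white G)" and start: "start G' = f (start G)"
    and labs: "labs G' = map f (labs G)" and orient: "orient G' = map f (orient G)"
    using iso unfolding bw_iso_def by blast
  have VH: "white G \<in> verts G" "start G \<in> hedges G" "src G (start G) = white G"
    "set (labs G) \<subseteq> hedges G"
    and R: "\<And>h. h \<in> hedges G \<Longrightarrow> src G h \<in> verts G \<and> opp G h \<in> hedges G \<and> opp G (opp G h) = h \<and>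
        nxt G h \<in> hedges G \<and> distinct (cyc G h) \<and> set (cyc G h) = hedges_at G (src G h) \<and>
        nxt G (last (cyc G h)) = h"
    using bw G by (auto simp: bw_graph_def ribbon_def hedges_at_def)
  have eq_iff: "f x = f y \<longleftrightarrow> x = y" if "x \<in> verts G \<union> hedges G" "y \<in> verts G \<union> hedges G" for x y
    using inj that by (auto dest: inj_onD)
  have injH: "inj_on f (hedges G)" and injat: "inj_on f (hedges_at G v)" for v
    using inj by (auto simp: hedges_at_def intro: inj_on_subset)
  have at: "hedges_at G' (f v) = f ` hedges_at G v" if "v \<in> verts G" for v
    using that R eq_iff by (auto simp: hedges_at_def H src)
  have card: "card (hedges_at G' (f v)) = card (hedges_at G v)" if "v \<in> verts G" for v
    using at[OF that] injat by (simp add: card_image)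
  have cyc: "cyc G' (f h) = map f (cyc G h)" if "h \<in> hedges G" for h
    using funpow_iso[of G "nxt G'" f h, OF G nxt that] that R[OF that] card by (simp add: cyc_def src)
  have black: "black G' = f ` black G"
    using V white VH eq_iff by (auto simp: black_def)
  have G': "ribbon G'"
    unfolding ribbon_def
  proof (intro conjI ballI)
    show "finite (verts G')" "finite (hedges G')" using G by (auto simp: ribbon_def V H)
    show "verts G' \<inter> hedges G' = {}"
      using G eq_iff by (force simp: ribbon_def V H)
    show "white G' \<in> verts G'" "start G' \<in> hedges_at G' (white G')"
      using VH by (auto simp: V H white start hedges_at_def src)
  next
    fix h' assume "h' \<in> hedges G'"
    then obtain h where h: "h \<in> hedges G" and h': "h' = f h" by (auto simp: H)
    have sub: "set (cyc G h) \<subseteq> hedges G" using R[OF h] by (auto simp: hedges_at_def)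
    have "cyc G h \<noteq> []" using valence_pos[OF G h] by (metis length_cyc length_greater_0_conv)
    then have l: "last (cyc G h) \<in> hedges G" "last (map f (cyc G h)) = f (last (cyc G h))"
      using sub by (auto simp: last_map)
    show "src G' h' \<in> verts G'" "opp G' h' \<in> hedges G'" "opp G' (opp G' h') = h'"
      "nxt G' h' \<in> hedges G'" "set (cyc G' h') = hedges_at G' (src G' h')"
      using R[OF h] h by (auto simp: h' src V opp H nxt cyc at)
    show "distinct (cyc G' h')"
      using R[OF h] h sub injH by (auto simp: h' cyc distinct_map intro: inj_on_subset)
    show "nxt G' (last (cyc G' h')) = h'"
      using R[OF h] h l by (simp add: h' cyc nxt)
  qed
  have tri: "trivalent G' \<longleftrightarrow> trivalent G"
    unfolding trivalent_def black ball_simps using card by (intro ball_cong) (auto simp: black_def)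
  have ul: "unlabelled_start G' \<longleftrightarrow> unlabelled_start G"
    using VH R eq_iff by (force simp: unlabelled_start_def opp start labs)
  have states: "c' \<in> states G' u \<longleftrightarrow> c \<in> states G u"
    if c: "c \<in> extensional (hedges G)" "c' \<in> extensional (hedges G')"
      "\<And>h. h \<in> hedges G \<Longrightarrow> c' (f h) = c h" for c c'
  proof -
    have "map c' (labs G') = map c (labs G)"
      using VH by (auto simp: labs c)
    moreover have "c' (start G') = c (start G)" using VH by (simp add: start c)
    moreover have "(\<Sum>h\<in>hedges_at G' (f v). c' h) = (\<Sum>h\<in>hedges_at G v. c h)" if "v \<in> black G" for v
      using that injat[of v]
      by (subst at) (auto simp: black_def sum.reindex hedges_at_def intro!: sum.cong c)
    moreover have "(\<forall>h\<in>hedges G'. opp G' h \<noteq> h \<longrightarrow> c' h + c' (opp G' h) = 1) \<longleftrightarrow>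
        (\<forall>h\<in>hedges G. opp G h \<noteq> h \<longrightarrow> c h + c (opp G h) = 1)"
      using R eq_iff by (auto simp: H opp c)
    moreover have "c' \<in> hedges G' \<rightarrow> {0, 1} \<longleftrightarrow> c \<in> hedges G \<rightarrow> {0, 1}"
      by (simp add: Pi_iff H c)
    ultimately show ?thesis
      using c by (simp add: states_def labellings_def balanced_def black ul PiE_def)
  qed
  let ?j = "\<lambda>c'. restrict (c' \<circ> f) (hedges G)"
  let ?i = "\<lambda>c. restrict (\<lambda>y. c (inv_into (hedges G) f y)) (hedges G')"
  have inv: "inv_into (hedges G) f (f h) = h" if "h \<in> hedges G" for h
    using injH that by simp
  have carrier: "c \<in> extensional (hedges K)" if "c \<in> states K u" for c K
    using that by (auto simp: states_def labellings_def PiE_def)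
  have sum: "state_sum G' u = (state_sum G u :: nat list \<Rightarrow>\<^sub>0 'r)"
    unfolding state_sum_def
  proof (rule sum.reindex_bij_witness[of _ ?i ?j])
    fix c' assume c': "c' \<in> states G' u"
    show "?i (?j c') = c'"
      using carrier[OF c'] by (intro ext) (auto simp: H inv extensional_def restrict_def)
    show "?j c' \<in> states G u"
      using c' by (subst states[symmetric, of _ c']) (auto simp: carrier)
    have "set (cyc G (start G)) \<subseteq> hedges G" using R VH by (auto simp: hedges_at_def)
    then show "tens (map (?j c') (cyc G (start G))) = (tens (map c' (cyc G' (start G'))) :: nat list \<Rightarrow>\<^sub>0 'r)"
      using VH by (intro arg_cong[of _ _ tens]) (auto simp: start cyc)
  next
    fix c assume c: "c \<in> states G u"
    show "?j (?i c) = c"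
      using carrier[OF c] by (intro ext) (auto simp: H inv extensional_def restrict_def)
    show "?i c \<in> states G' u"
      using c by (subst states[of c]) (auto simp: carrier H inv)
  qed
  have "cut_sign G' = cut_sign G" if t: "trivalent G"
  proof -
    let ?b = "\<lambda>v. v # cyc G (Min (hedges_at G v))" and ?b' = "\<lambda>v. v # cyc G' (Min (hedges_at G' v))"
    let ?vs = "sorted_list_of_set (black G)"
    have fin: "finite (black G)" using G by (simp add: ribbon_def black_def)
    have three: "card (hedges_at G v) = 3" if "v \<in> black G" for v
      using t that by (simp add: trivalent_def)
    have three': "card (hedges_at G' v) = 3" if "v \<in> black G'" for v
      using t that unfolding tri[symmetric] by (simp add: trivalent_def)
    have ne: "hedges_at G v \<noteq> {}" "v \<in> verts G" if "v \<in> black G" for v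
      using three[OF that] that by (auto simp: black_def)
    have ne': "hedges_at G' v \<noteq> {}" if "v \<in> black G'" for v
      using three'[OF that] by auto
    have set: "set (orient G) = set (cut_orientation G)" "distinct (orient G)" "distinct (cut_orientation G)"
      using bw cut_orientation_distinct[OF G ne(1)] by (auto simp: bw_graph_def)
    have "set (cut_orientation G) \<subseteq> verts G \<union> hedges G" "distinct (cut_orientation G')"
      using cut_orientation_distinct[OF G ne(1)] cut_orientation_distinct[OF G' ne'] by auto
    then have d: "distinct (map f (cut_orientation G))" "distinct (cut_orientation G')"
      using set inj by (auto simp: distinct_map intro: inj_on_subset)
    \<comment> \<open>The least half-edge at a vertex need not be mapped to the least one: a rotation of three half-edges.\<close>
    have "rearr 1 (map f (?b v)) (?b' (f v))" if v: "v \<in> black G" for v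
    proof -
      have "Min (hedges_at G v) \<in> hedges_at G v" "Min (hedges_at G' (f v)) \<in> hedges_at G' (f v)"
        using ne[OF v] ne'[of "f v"] v finite_hedges_at G G' by (auto simp: black intro!: Min_in)
      moreover from this have "map f (cyc G (Min (hedges_at G v))) = cyc G' (f (Min (hedges_at G v)))"
        by (simp add: cyc hedges_at_def)
      moreover have "card (hedges_at G' (f v)) = 3" using v by (simp add: three' black)
      ultimately show ?thesis
        using ne[OF v] by (auto intro!: rearr_Cons rearr_cyc[OF G', of _ "f v"] simp: at)
    qed
    then have "rearr 1 (concat (map (\<lambda>v. map f (?b v)) ?vs)) (concat (map (\<lambda>v. ?b' (f v)) ?vs))"
      using fin by (intro rearr_concat) simp
    \<comment> \<open>The isomorphism need not be monotone on vertices: a permutation of blocks of length four.\<close>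
    moreover have "rearr 1 (concat (map ?b' (map f ?vs))) (concat (map ?b' (sorted_list_of_set (black G'))))"
    proof -
      have "inj_on f (black G)" using inj by (rule inj_on_subset) (auto simp: black_def)
      then have "distinct (map f ?vs)" "set (map f ?vs) = set (sorted_list_of_set (black G'))"
        using fin by (auto simp: distinct_map black)
      then have "mset (map f ?vs) = mset (sorted_list_of_set (black G'))"
        by (metis distinct_sorted_list_of_set mset_set_set)
      then obtain s where "rearr s (map f ?vs) (sorted_list_of_set (black G'))" by (rule rearr_exists)
      then show ?thesis
      proof (rule rearr_even_blocks)
        fix v' assume "v' \<in> set (map f ?vs)"
        then have v': "v' \<in> black G'" using fin by (auto simp: black)
        then have "Min (hedges_at G' v') \<in> hedges_at G' v'"
          using ne' finite_hedges_at[OF G'] by (auto intro!: Min_in)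
        then show "even (length (?b' v'))"
          using v' t unfolding tri[symmetric] by (simp add: trivalent_def hedges_at_def)
      qed
    qed
    ultimately have "rearr 1 (concat (map (\<lambda>v. map f (?b v)) ?vs)) (concat (map ?b' (sorted_list_of_set (black G'))))"
      using rearr_trans[of 1 _ _ 1] by (simp add: comp_def)
    from rearr_context[OF this, of "f (white G) # map f (cyc G (start G))" "[]"]
    have "rearr 1 (map f (cut_orientation G)) (cut_orientation G')"
      using VH by (simp add: cut_orientation_def white start cyc map_concat comp_def)
    from list_sign_rearr[OF this d(1)]
    have "list_sign (cut_orientation G') = list_sign (map f (cut_orientation G))" by simp
    then have "cut_sign G' = list_sign (map f (orient G)) * list_sign (map f (cut_orientation G))"
      by (simp add: cut_sign_def orient)
    also have "\<dots> = cut_sign G"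
      unfolding cut_sign_def
    proof (rule relative_sign_map)
      show "mset (orient G) = mset (cut_orientation G)" using set by (metis mset_set_set)
      show "inj_on f (set (orient G))" using bw inj by (simp add: bw_graph_def)
    qed (rule set)
    finally show ?thesis .
  qed
  then show ?thesis by (simp add: cut_op_eq[OF G] cut_op_eq[OF G'] tri sum)
qed

lemma orient_cut_op:
  assumes "ribbon G"
  shows "cut_op (G\<lparr>orient := xs\<rparr>) u =
    (scale (of_int (list_sign (orient G) * list_sign xs)) (cut_op G u) :: nat list \<Rightarrow>\<^sub>0 'r::comm_ring_1)"
proof -
  let ?G' = "G\<lparr>orient := xs\<rparr>"
  have at: "hedges_at ?G' = hedges_at G" by (simp add: hedges_at_def fun_eq_iff)
  have cyc: "cyc ?G' = cyc G" by (simp add: cyc_def fun_eq_iff at)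
  have black: "black ?G' = black G" by (simp add: black_def)
  have G': "ribbon ?G'" using assms by (simp add: ribbon_def at cyc)
  have "trivalent ?G' = trivalent G" by (simp add: trivalent_def at black)
  moreover have "states ?G' u = states G u"
    by (simp add: states_def labellings_def balanced_def at black unlabelled_start_def)
  moreover have "cut_sign ?G' = list_sign (orient G) * list_sign xs * cut_sign G"
    using list_sign_square[of "orient G"]
    by (simp add: cut_sign_def cut_orientation_def at cyc black mult.left_commute)
  ultimately show ?thesis
    by (simp add: cut_op_eq[OF assms] cut_op_eq[OF G'] state_sum_def cyc)
qed

section \<open>The two blow-ups of a vertex of valence four\<close>

lemma less_fresh:
  assumes "ribbon G" "y \<in> verts G \<union> hedges G"
  shows "y < fresh G"
  using assms by (auto simp: fresh_def ribbon_def less_Suc_eq_le)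

lemma blow_up_simps:
  "verts (blow_up G h p) = insert (fresh G) (verts G)"
  "hedges (blow_up G h p) = {fresh G + 1, fresh G + 2} \<union> hedges G"
  "white (blow_up G h p) = white G"
  "labs (blow_up G h p) = labs G"
  "start (blow_up G h p) = (if start G \<in> set (take p (cyc G h)) then fresh G + 1 else start G)"
  "opp (blow_up G h p) = (opp G)(fresh G + 1 := fresh G + 2, fresh G + 2 := fresh G + 1)"
  "src (blow_up G h p) y = (if y = fresh G + 2 \<or> y \<in> set (take p (cyc G h)) then fresh G
     else if y = fresh G + 1 then src G h else src G y)"
  "orient (blow_up G h p) = src G h # (fresh G + 1) # fresh G # (fresh G + 2) # remove1 (src G h) (orient G)"
  by (simp_all add: blow_up_def Let_def)

lemma black_blow_up:
  assumes "ribbon G"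
  shows "black (blow_up G h p) = insert (fresh G) (black G)"
  using less_fresh[OF assms, of "white G"] assms by (auto simp: black_def blow_up_simps ribbon_def)

lemma hedges_at_blow_up:
  assumes G: "ribbon G" and h: "h \<in> hedges G"
  shows "hedges_at (blow_up G h p) (fresh G) = insert (fresh G + 2) (set (take p (cyc G h)))"
    and "hedges_at (blow_up G h p) (src G h) =
      insert (fresh G + 1) (hedges_at G (src G h) - set (take p (cyc G h)))"
    and "v \<noteq> src G h \<Longrightarrow> v \<noteq> fresh G \<Longrightarrow> hedges_at (blow_up G h p) v = hedges_at G v"
proof -
  let ?B = "blow_up G h p" and ?u = "fresh G"
  define A where "A = set (take p (cyc G h))"
  have A: "A \<subseteq> hedges G" "\<And>y. y \<in> A \<Longrightarrow> src G y = src G h"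
    using G h set_take_subset[of p "cyc G h"] by (auto simp: ribbon_def A_def hedges_at_def)
  have lt: "y < ?u" "src G y < ?u" if "y \<in> hedges G" for y
    using less_fresh[OF G] G that by (auto simp: ribbon_def)
  have new: "?u + 1 \<notin> hedges G" "?u + 2 \<notin> hedges G"
    using lt(1)[of "?u + 1"] lt(1)[of "?u + 2"] by auto
  have u: "src G y \<noteq> ?u" if "y \<in> hedges G" for y
    using lt(2)[OF that] by simp
  have hed: "hedges ?B = {?u + 1, ?u + 2} \<union> A \<union> (hedges G - A)"
    using A by (auto simp: blow_up_simps)
  have srcs: "src ?B (?u + 2) = ?u" "src ?B (?u + 1) = src G h"
    "\<And>y. y \<in> A \<Longrightarrow> src ?B y = ?u" "\<And>y. y \<in> hedges G - A \<Longrightarrow> src ?B y = src G y"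
    using new A by (auto simp: blow_up_simps A_def[symmetric])
  have at: "hedges_at ?B t = {y \<in> {?u + 1}. src G h = t} \<union> {y \<in> {?u + 2} \<union> A. ?u = t} \<union>
      {y \<in> hedges G - A. src G y = t}" for t
    unfolding hedges_at_def hed using srcs by (intro set_eqI) (smt (verit) Un_iff insert_iff empty_iff mem_Collect_eq)
  show "hedges_at ?B ?u = insert (?u + 2) (set (take p (cyc G h)))"
    unfolding at A_def[symmetric] using u h by auto
  show "hedges_at ?B (src G h) =
      insert (?u + 1) (hedges_at G (src G h) - set (take p (cyc G h)))"
    unfolding at A_def[symmetric] using u[OF h] by (auto simp: hedges_at_def)
  show "hedges_at ?B v = hedges_at G v" if "v \<noteq> src G h" "v \<noteq> ?u"
    unfolding at using that A by (auto simp: hedges_at_def)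
qed

text \<open>
  A blow-up changes only the vertex to which it is applied, and splits its valence n into p + 1 and
  n - p + 1.  Both are 3 only for n = 4 and p = 2.
\<close>

lemma trivalent_blow_up_imp:
  assumes G: "ribbon G" and data: "(h, p) \<in> blow_up_data G"
    and v: "v \<in> black G" "card (hedges_at G v) \<ge> 4"
    and tri: "trivalent (blow_up G h p)"
  shows "src G h = v" "p = 2" "card (hedges_at G v) = 4"
proof -
  have h: "h \<in> hedges G" using data by (simp add: blow_up_data_def)
  have uv: "fresh G \<noteq> v" using less_fresh[OF G, of v] v by (auto simp: black_def)
  have 3: "card (hedges_at (blow_up G h p) t) = 3" if "t \<in> insert (fresh G) (black G)" for t
    using tri that unfolding trivalent_def black_blow_up[OF G] by blast
  show s: "src G h = v"
    using 3[of v] v hedges_at_blow_up(3)[OF G h, of v p] uv by (cases "src G h = v") auto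
  have "v \<noteq> white G" using v by (auto simp: black_def)
  then have p: "p + 2 \<le> card (hedges_at G v)" using data s by (simp add: blow_up_data_def)
  let ?A = "set (take p (cyc G h))"
  have "distinct (cyc G h)" "set (cyc G h) = hedges_at G v" using G h s by (auto simp: ribbon_def)
  moreover from this have A: "?A \<subseteq> hedges_at G v" using set_take_subset by metis
  ultimately have cA: "card ?A = p" using p s by (simp add: distinct_card distinct_take)
  have new: "y \<noteq> fresh G + 1" "y \<noteq> fresh G + 2" if "y \<in> hedges_at G v" for y
    using less_fresh[OF G, of y] that by (auto simp: hedges_at_def)
  have "fresh G + 2 \<notin> ?A" using A new by blast
  then have "card (hedges_at (blow_up G h p) (fresh G)) = p + 1"
    using cA by (simp add: hedges_at_blow_up(1)[OF G h])
  with 3 show "p = 2" by simp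
  have "fresh G + 1 \<notin> hedges_at G v - ?A" using new by blast
  then have "card (hedges_at (blow_up G h p) v) = card (hedges_at G v) - p + 1"
    using cA A finite_hedges_at[OF G, of v] hedges_at_blow_up(2)[OF G h, of p] s
    by (simp add: card_Diff_subset)
  with 3[of v] v p \<open>p = 2\<close> show "card (hedges_at G v) = 4" by simp
qed

text \<open>
  A black vertex v with the half-edges x, y, z, w in cyclic order.  The blow-up which moves x and y to the
  new vertex leaves z and w at v; the other blow-up is the same construction for y, z, w, x.
\<close>

locale four_valent =
  fixes G v x y z w
  assumes G: "ribbon G" and v: "v \<in> black G"
    and at: "hedges_at G v = {x, y, z, w}" and dist: "distinct [x, y, z, w]"
    and nxt: "nxt G x = y" "nxt G y = z" "nxt G z = w" "nxt G w = x"
begin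

abbreviation "B \<equiv> blow_up G x 2"
abbreviation "u \<equiv> fresh G"
abbreviation "e \<equiv> fresh G + 1"
abbreviation "e' \<equiv> fresh G + 2"

lemma hedges: "x \<in> hedges G" "y \<in> hedges G" "z \<in> hedges G" "w \<in> hedges G"
  and src: "src G x = v" "src G y = v" "src G z = v" "src G w = v"
  using at by (auto simp: hedges_at_def)

lemma take_cyc: "take 2 (cyc G x) = [x, y]"
  using dist by (simp add: cyc_def src at nxt numeral_2_eq_2 take_map)

lemma old: "t \<in> verts G \<union> hedges G \<Longrightarrow> t < u"
  by (rule less_fresh[OF G])

lemma at_u: "hedges_at B u = {e', x, y}"
  using hedges_at_blow_up(1)[OF G hedges(1), of 2] by (simp add: take_cyc)

lemma at_v: "hedges_at B v = {e, z, w}"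
  using hedges_at_blow_up(2)[OF G hedges(1), of 2] dist by (auto simp: take_cyc src at)

lemma at_other: "t \<noteq> v \<Longrightarrow> t \<noteq> u \<Longrightarrow> hedges_at B t = hedges_at G t"
  using hedges_at_blow_up(3)[OF G hedges(1), of t 2] by (simp add: src)

lemma u_v: "u \<noteq> v"
  using old[of v] v by (auto simp: black_def)

lemma new: "e \<notin> hedges G" "e' \<notin> hedges G"
  using old[of e] old[of e'] by auto

lemma distinct_new: "distinct [e, e', x, y, z, w]"
  using dist new hedges by auto

lemma nxt_B:
  "nxt B e = z" "nxt B z = w" "nxt B w = e" "nxt B e' = x" "nxt B x = y" "nxt B y = e'"
  using distinct_new by (auto simp: blow_up_def Let_def take_cyc nxt)

lemma nxt_B_other: "t \<in> hedges G \<Longrightarrow> src G t \<noteq> v \<Longrightarrow> nxt B t = nxt G t"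
proof -
  assume t: "t \<in> hedges G" "src G t \<noteq> v"
  then have "src G (nxt G t) = src G t"
    using nxt_in_hedges_at[OF G, of t "src G t"] by (simp add: hedges_at_def)
  then have "nxt G t \<noteq> x" "t \<noteq> x" "t \<noteq> y" using t src by auto
  then show "nxt B t = nxt G t"
    using old[of t] t by (auto simp: blow_up_def Let_def take_cyc src)
qed

lemma cyc_B:
  "cyc B e = [e, z, w]" "cyc B z = [z, w, e]" "cyc B w = [w, e, z]"
  "cyc B e' = [e', x, y]" "cyc B x = [x, y, e']" "cyc B y = [y, e', x]"
proof -
  have "src B e = v" "src B z = v" "src B w = v" "src B e' = u" "src B x = u" "src B y = u"
    using at_u at_v by (auto simp: hedges_at_def)
  then show "cyc B e = [e, z, w]" "cyc B z = [z, w, e]" "cyc B w = [w, e, z]"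
    "cyc B e' = [e', x, y]" "cyc B x = [x, y, e']" "cyc B y = [y, e', x]"
    unfolding cyc_def using distinct_new by (simp_all add: at_u at_v nxt_B[simplified])
qed

lemma src_B_other: "t \<in> hedges G \<Longrightarrow> src G t \<noteq> v \<Longrightarrow> src B t = src G t"
  using new by (auto simp: blow_up_simps take_cyc src)

lemma cyc_B_other:
  assumes "t \<in> hedges G" "src G t \<noteq> v"
  shows "cyc B t = cyc G t"
proof -
  have "(nxt B ^^ i) t = (nxt G ^^ i) t" for i
  proof (induction i)
    case (Suc i)
    have "(nxt G ^^ i) t \<in> hedges_at G (src G t)"
      using funpow_nxt_in_hedges_at[OF G] assms by (simp add: hedges_at_def)
    with Suc assms show ?case by (simp add: nxt_B_other hedges_at_def)
  qed simp
  moreover have "src G t \<noteq> u" using old[of "src G t"] G assms by (auto simp: ribbon_def)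
  ultimately show ?thesis
    using assms by (simp add: cyc_def src_B_other at_other)
qed

lemma start: "start G \<in> hedges G" "src G (start G) \<noteq> v" "start B = start G"
proof -
  show s: "start G \<in> hedges G" "src G (start G) \<noteq> v"
    using G v by (auto simp: ribbon_def hedges_at_def black_def)
  then have "start G \<noteq> x" "start G \<noteq> y" using src by auto
  then show "start B = start G" by (simp add: blow_up_simps take_cyc)
qed

lemma ribbon_B: "ribbon B"
proof -
  have r: "t \<in> hedges G \<Longrightarrow> src G t \<in> verts G \<and> opp G t \<in> hedges G \<and> opp G (opp G t) = t \<and>
        nxt G t \<in> hedges G \<and> distinct (cyc G t) \<and> set (cyc G t) = hedges_at G (src G t) \<and>
        nxt G (last (cyc G t)) = t" for t
    using G by (simp add: ribbon_def)
  have vv: "v \<in> verts G" "white G \<noteq> v" "white G \<noteq> u"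
    using v G old[of "white G"] by (auto simp: black_def ribbon_def)
  have "src B t \<in> verts B \<and> opp B t \<in> hedges B \<and> opp B (opp B t) = t" if "t \<in> hedges B" for t
  proof (cases "t \<in> hedges G")
    case True
    then have "opp G t \<noteq> e" "opp G t \<noteq> e'" "t \<noteq> e" "t \<noteq> e'" using new r[of t] by auto
    with True r[of t] show ?thesis by (auto simp: blow_up_simps src vv)
  next
    case False
    with that show ?thesis by (auto simp: blow_up_simps src vv)
  qed
  moreover have "nxt B t \<in> hedges B \<and> distinct (cyc B t) \<and> set (cyc B t) = hedges_at B (src B t) \<and>
      nxt B (last (cyc B t)) = t" if "t \<in> hedges B" for t
  proof (cases "t \<in> hedges G \<and> src G t \<noteq> v")
    case True
    have "src G t \<noteq> u" using old[of "src G t"] r True by auto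
    have "cyc G t \<noteq> []" using r[of t] True by (auto simp: hedges_at_def)
    then have "last (cyc G t) \<in> hedges_at G (src G t)"
      using r[of t] True last_in_set by metis
    then have "nxt B (last (cyc G t)) = t"
      using True r[of t] by (auto simp: nxt_B_other hedges_at_def)
    then show ?thesis using True r[of t] \<open>src G t \<noteq> u\<close>
      by (simp add: cyc_B_other nxt_B_other src_B_other at_other) (simp add: blow_up_simps)
  next
    case False
    then have "t \<in> {e, z, w} \<or> t \<in> {e', x, y}"
      using that at by (auto simp: blow_up_simps hedges_at_def)
    then show ?thesis
    proof
      assume t: "t \<in> {e, z, w}"
      then have s: "src B t = v" using at_v by (auto simp: hedges_at_def)
      show ?thesis unfolding s at_v using t distinct_new hedges
        by (auto simp: cyc_B[simplified] nxt_B[simplified]) (auto simp: blow_up_simps)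
    next
      assume t: "t \<in> {e', x, y}"
      then have s: "src B t = u" using at_u by (auto simp: hedges_at_def)
      show ?thesis unfolding s at_u using t distinct_new hedges
        by (auto simp: cyc_B[simplified] nxt_B[simplified]) (auto simp: blow_up_simps)
    qed
  qed
  moreover have "verts B \<inter> hedges B = {}"
    using G old new by (force simp: blow_up_simps ribbon_def)
  moreover have "start B \<in> hedges_at B (white B)"
    using start G vv by (simp add: blow_up_simps(3) at_other ribbon_def)
  ultimately show ?thesis
    using G unfolding ribbon_def by (auto simp: blow_up_simps)
qed

text \<open>
  Here c' extends c to the new edge.  The hypotheses on c' state balance at the new vertex and on the new edge;
  under them, balance at v in the blow-up means balance of all four old half-edges.
\<close>

lemma states_B:
  assumes c: "\<And>t. t \<in> hedges G \<Longrightarrow> c t = c' t"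
    and ext: "c \<in> extensional (hedges G)" "c' \<in> extensional (hedges B)"
    and new_val: "c' e' + c' x + c' y = 1" "c' e + c' e' = 1"
    and labs: "set (labs G) \<subseteq> hedges G"
  shows "c' \<in> states B us \<longleftrightarrow> c \<in> states G us"
proof -
  have cc: "c x = c' x" "c y = c' y" "c z = c' z" "c w = c' w" using c hedges by auto
  have "c' \<in> hedges B \<rightarrow> {0, 1} \<longleftrightarrow> c' \<in> hedges G \<rightarrow> {0, 1}"
    using new_val by (auto simp: blow_up_simps Pi_iff)
  also have "\<dots> \<longleftrightarrow> c \<in> hedges G \<rightarrow> {0, 1}" by (simp add: Pi_iff c)
  finally have 1: "c' \<in> hedges B \<rightarrow> {0, 1} \<longleftrightarrow> c \<in> hedges G \<rightarrow> {0, 1}" .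
  have 2: "map c' (labs B) = map c (labs G)" using labs c by (auto simp: blow_up_simps)
  have "start G \<noteq> e" "start G \<noteq> e'" using new start by auto
  then have 3: "unlabelled_start B \<longleftrightarrow> unlabelled_start G" "c' (start B) = c (start G)"
    using start c by (auto simp: unlabelled_start_def blow_up_simps)
  have "(\<forall>t\<in>black G - {v}. (\<Sum>h\<in>hedges_at B t. c' h) = 1) \<longleftrightarrow>
      (\<forall>t\<in>black G - {v}. (\<Sum>h\<in>hedges_at G t. c h) = 1)"
  proof (rule ball_cong[OF HOL.refl])
    fix t assume t: "t \<in> black G - {v}"
    then have "t \<noteq> u" using old[of t] by (auto simp: black_def)
    with t have "hedges_at B t = hedges_at G t" by (simp add: at_other)
    then show "((\<Sum>h\<in>hedges_at B t. c' h) = 1) = ((\<Sum>h\<in>hedges_at G t. c h) = 1)"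
      using c sum.cong[of "hedges_at G t" "hedges_at G t" c c'] by (simp add: hedges_at_def)
  qed
  moreover have "(\<Sum>h\<in>hedges_at B v. c' h) = 1 \<longleftrightarrow> (\<Sum>h\<in>hedges_at G v. c h) = 1"
  proof -
    have "(\<Sum>h\<in>hedges_at B v. c' h) = c' e + c' z + c' w"
      using distinct_new by (simp add: at_v)
    moreover have "(\<Sum>h\<in>hedges_at G v. c h) = c' x + c' y + c' z + c' w"
      using dist by (simp add: at cc)
    ultimately show ?thesis using new_val by linarith
  qed
  moreover have "(\<Sum>h\<in>hedges_at B u. c' h) = 1"
    unfolding at_u using distinct_new new_val by auto
  moreover have "black B = insert u (insert v (black G - {v}))" "black G = insert v (black G - {v})"
    using v black_blow_up[OF G] by auto
  ultimately have 4: "(\<forall>t\<in>black B. (\<Sum>h\<in>hedges_at B t. c' h) = 1) \<longleftrightarrow>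
      (\<forall>t\<in>black G. (\<Sum>h\<in>hedges_at G t. c h) = 1)"
    by (metis insert_iff)
  have o: "opp G t \<in> hedges G" if "t \<in> hedges G" for t using that G by (simp add: ribbon_def)
  have "(\<forall>t\<in>hedges G. opp B t \<noteq> t \<longrightarrow> c' t + c' (opp B t) = 1) \<longleftrightarrow>
      (\<forall>t\<in>hedges G. opp G t \<noteq> t \<longrightarrow> c t + c (opp G t) = 1)"
  proof (rule ball_cong[OF HOL.refl])
    fix t assume t: "t \<in> hedges G"
    then have "opp B t = opp G t" using new by (auto simp: blow_up_simps)
    then show "(opp B t \<noteq> t \<longrightarrow> c' t + c' (opp B t) = 1) = (opp G t \<noteq> t \<longrightarrow> c t + c (opp G t) = 1)"
      using t o[OF t] c by simp
  qed
  then have 5: "(\<forall>t\<in>hedges B. opp B t \<noteq> t \<longrightarrow> c' t + c' (opp B t) = 1) \<longleftrightarrow>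
      (\<forall>t\<in>hedges G. opp G t \<noteq> t \<longrightarrow> c t + c (opp G t) = 1)"
    using new_val by (simp add: blow_up_simps(2) ball_Un) (simp add: blow_up_simps add.commute)
  show ?thesis
    using ext unfolding states_def labellings_def balanced_def PiE_def
    by (simp add: 1[simplified] 2 3 4[simplified] 5[simplified])
qed

text \<open>
  The two ends of the new edge carry complementary labels, and each of them is determined by
  the old half-edges at its vertex.  Eliminating them leaves the balance condition
  of the vertex of valence four, so restriction to the old half-edges is a bijection of balanced
  labellings.
\<close>

lemma state_sum_B:
  assumes labs: "set (labs G) \<subseteq> hedges G"
  shows "state_sum B us = (state_sum G us :: nat list \<Rightarrow>\<^sub>0 'r::comm_ring_1)"
proof -
  let ?j = "\<lambda>c'. restrict c' (hedges G)"
  let ?i = "\<lambda>c t. if t = e' then 1 - (c x + c y) else if t = e then 1 - (c z + c w) else c t"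
  have ext: "c \<in> extensional (hedges K)" if "c \<in> states K us" for c K
    using that by (auto simp: states_def labellings_def PiE_def)
  have ne: "e \<noteq> x" "e \<noteq> y" "e \<noteq> z" "e \<noteq> w" "e' \<noteq> x" "e' \<noteq> y" "e' \<noteq> z" "e' \<noteq> w"
    using distinct_new by auto
  have B: "c' e' + c' x + c' y = 1" "c' e + c' z + c' w = 1" "c' e + c' e' = 1"
    if "c' \<in> states B us" for c'
  proof -
    have "balanced B c'" using that by (simp add: states_def)
    moreover have "u \<in> black B" "v \<in> black B" using v black_blow_up[OF G] by auto
    ultimately have "(\<Sum>h\<in>hedges_at B u. c' h) = 1" "(\<Sum>h\<in>hedges_at B v. c' h) = 1"
      by (auto simp: balanced_def)
    then show "c' e' + c' x + c' y = 1" "c' e + c' z + c' w = 1"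
      using distinct_new by (simp_all add: at_u at_v add.assoc)
    have "e \<in> hedges B" "opp B e = e'" by (auto simp: blow_up_simps)
    then show "c' e + c' e' = 1" using \<open>balanced B c'\<close> unfolding balanced_def by fastforce
  qed
  show ?thesis
    unfolding state_sum_def
  proof (rule sum.reindex_bij_witness[of _ ?i ?j])
    fix c' assume c': "c' \<in> states B us"
    have "?i (?j c') t = c' t" for t
    proof -
      consider "t = e'" | "t = e" | "t \<noteq> e" "t \<noteq> e'" "t \<in> hedges G" | "t \<notin> hedges B"
        by (auto simp: blow_up_simps)
      then show ?thesis
        using B[OF c'] ext[OF c'] hedges new
        by cases (auto simp: extensional_def blow_up_simps)
    qed
    then show "?i (?j c') = c'" by blast
    show "?j c' \<in> states G us"
      using c' B[OF c'] ext[OF c'] labs by (subst states_B[symmetric, of _ c']) auto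
    have "set (cyc G (start G)) \<subseteq> hedges G"
      using G start by (auto simp: ribbon_def hedges_at_def)
    then show "tens (map (?j c') (cyc G (start G))) =
        (tens (map c' (cyc B (start B))) :: nat list \<Rightarrow>\<^sub>0 'r)"
      by (intro arg_cong[of _ _ tens]) (auto simp: start(3) cyc_B_other start(1,2))
  next
    fix c assume c: "c \<in> states G us"
    show "?j (?i c) = c"
      using ext[OF c] new by (intro HOL.ext) (auto simp: extensional_def)
    have "(\<Sum>h\<in>hedges_at G v. c h) = 1" using c v by (simp add: states_def balanced_def)
    then have "c x + c y + c z + c w = 1" using dist by (simp add: at add.assoc)
    then show "?i c \<in> states B us"
      using c ext[OF c] labs ne new by (subst states_B[of c]) (auto simp: extensional_def blow_up_simps)
  qed
qed

definition other_blocks :: "nat list" where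
  "other_blocks = concat (map (\<lambda>t. t # cyc G (Min (hedges_at G t))) (sorted_list_of_set (black G - {v})))"

text \<open>
  Up to an even rearrangement, the canonical orientation of the blow-up has the blocks of the
  two vertices in question in front of those of the other black vertices; the latter are
  independent of which of the two blow-ups is taken.
\<close>

lemma cut_orientation_B:
  assumes tri: "trivalent B"
  shows "rearr 1 (white G # cyc G (start G) @ [v, e, z, w, u, e', x, y] @ other_blocks) (cut_orientation B)"
proof -
  let ?b = "\<lambda>t. t # cyc B (Min (hedges_at B t))"
  let ?ts = "sorted_list_of_set (black G - {v})" and ?bs = "sorted_list_of_set (black B)"
  have fin: "finite (black G)" using G by (simp add: ribbon_def black_def)
  have three: "card (hedges_at B t) = 3" if "t \<in> black B" for t
    using tri that by (simp add: trivalent_def)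
  have Min: "Min (hedges_at B t) \<in> hedges_at B t" if "t \<in> black B" for t
    using three[OF that] by (intro Min_in) (auto intro: card_ge_0_finite)
  have uv: "u \<in> black B" "v \<in> black B" using v black_blow_up[OF G] by auto
  have "rearr 1 [v, e, z, w] (?b v)" "rearr 1 [u, e', x, y] (?b u)"
  proof -
    have "e \<in> hedges_at B v" "e' \<in> hedges_at B u" by (simp_all add: at_u at_v)
    then have "rearr 1 (cyc B e) (cyc B (Min (hedges_at B v)))"
        "rearr 1 (cyc B e') (cyc B (Min (hedges_at B u)))"
      using rearr_cyc[OF ribbon_B] Min three uv by simp_all
    then show "rearr 1 [v, e, z, w] (?b v)" "rearr 1 [u, e', x, y] (?b u)"
      unfolding cyc_B by (auto intro: rearr_Cons)
  qed
  then have "rearr (1 * 1) ([v, e, z, w] @ [u, e', x, y]) (?b v @ ?b u)"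
    by (rule rearr_append)
  from rearr_context[OF this, of "[]" other_blocks]
  have "rearr 1 ([v, e, z, w, u, e', x, y] @ other_blocks) (?b v @ ?b u @ other_blocks)" by simp
  moreover have "other_blocks = concat (map ?b ?ts)"
    unfolding other_blocks_def
  proof (intro arg_cong[of _ _ concat] map_cong[OF HOL.refl])
    fix t assume "t \<in> set ?ts"
    then have t: "t \<in> black G" "t \<noteq> v" using fin by auto
    then have "t \<noteq> u" using old[of t] by (auto simp: black_def)
    with t have at_t: "hedges_at B t = hedges_at G t" by (simp add: at_other)
    have "Min (hedges_at G t) \<in> hedges_at G t"
      using Min[of t] t black_blow_up[OF G] at_t by simp
    then have "cyc B (Min (hedges_at G t)) = cyc G (Min (hedges_at G t))"
      using t by (intro cyc_B_other) (auto simp only: dest!: hedges_atD)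
    then show "t # cyc G (Min (hedges_at G t)) = ?b t"
      by (simp only: at_t)
  qed
  ultimately have 1: "rearr 1 ([v, e, z, w, u, e', x, y] @ other_blocks) (concat (map ?b (v # u # ?ts)))"
    by simp
  have "u \<notin> black G" using old[of u] by (auto simp: black_def)
  moreover have "set ?bs = insert u (black G)" "set ?ts = black G - {v}"
    using fin black_blow_up[OF G] by (simp_all only: set_sorted_list_of_set finite_insert finite_Diff)
  ultimately have "set (v # u # ?ts) = set ?bs" "distinct (v # u # ?ts)"
    using v u_v by auto
  then have "mset (v # u # ?ts) = mset ?bs" by (metis distinct_sorted_list_of_set mset_set_set)
  then obtain s where "rearr s (v # u # ?ts) ?bs" by (rule rearr_exists)
  then have 2: "rearr 1 (concat (map ?b (v # u # ?ts))) (concat (map ?b ?bs))"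
  proof (rule rearr_even_blocks)
    fix t assume "t \<in> set (v # u # ?ts)"
    then have t: "t \<in> black B" using uv fin black_blow_up[OF G] by auto
    then show "even (length (?b t))" using Min[OF t] three by (simp add: hedges_at_def)
  qed
  from rearr_trans[OF 2 1]
  have "rearr 1 ([v, e, z, w, u, e', x, y] @ other_blocks) (concat (map ?b ?bs))" by simp
  from rearr_context[OF this, of "white G # cyc G (start G)" "[]"]
  show ?thesis
    by (simp add: cut_orientation_def blow_up_simps(3) start(3) cyc_B_other start(1,2))
qed

end

text \<open>
  Moving blocks of even length, both sides become v, e, u, e' followed by the four old
  half-edges, in orders which differ by a cyclic rotation of length four, an odd permutation.
\<close>

lemma rearr_opposite_blow_ups:
  "rearr (- 1) [v, e, z, w, u, e', x, y] [v, e, w, x, u, e', y, z]"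
proof -
  have "rearr 1 ([z, w] @ [u, e', x, y]) ([u, e', x, y] @ [z, w])"
    using rearr_swap_blocks[of "[z, w]" "[u, e', x, y]"] by simp
  from rearr_context[OF this, of "[v, e]" "[]"]
  have 1: "rearr 1 [v, e, z, w, u, e', x, y] [v, e, u, e', x, y, z, w]" by simp
  have "rearr (- 1) ([x, y, z] @ [w]) ([w] @ [x, y, z])"
    using rearr_swap_blocks[of "[x, y, z]" "[w]"] by simp
  from rearr_context[OF this, of "[v, e, u, e']" "[]"]
  have 2: "rearr (- 1) [v, e, u, e', x, y, z, w] [v, e, u, e', w, x, y, z]" by simp
  have "rearr 1 ([u, e'] @ [w, x]) ([w, x] @ [u, e'])"
    using rearr_swap_blocks[of "[u, e']" "[w, x]"] by simp
  from rearr_context[OF this, of "[v, e]" "[y, z]"]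
  have 3: "rearr 1 [v, e, u, e', w, x, y, z] [v, e, w, x, u, e', y, z]" by simp
  from rearr_trans[OF 3 rearr_trans[OF 2 1]] show ?thesis by simp
qed

text \<open>
  The given orientations of the two blow-ups coincide as lists.  So the quotient of the signs is that of
  the canonical orientations.
\<close>

lemma cut_op_opposite_blow_ups:
  assumes "four_valent G v x y z w" and labs: "set (labs G) \<subseteq> hedges G"
  shows "cut_op (blow_up G y 2) us = - (cut_op (blow_up G x 2) us :: nat list \<Rightarrow>\<^sub>0 'r::comm_ring_1)"
proof -
  interpret X: four_valent G v x y z w by (rule assms)
  interpret Y: four_valent G v y z w x
    using X.G X.v X.at X.dist X.nxt by unfold_locales auto
  have tri: "trivalent Y.B \<longleftrightarrow> trivalent X.B"
  proof -
    have "card (hedges_at Y.B t) = card (hedges_at X.B t)" for t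
    proof -
      have "card (hedges_at Y.B v) = 3" "card (hedges_at X.B v) = 3"
        "card (hedges_at Y.B X.u) = 3" "card (hedges_at X.B X.u) = 3"
        using X.distinct_new unfolding X.at_v Y.at_v X.at_u Y.at_u by auto
      then show ?thesis using X.at_other[of t] Y.at_other[of t] by metis
    qed
    then show ?thesis by (simp add: trivalent_def black_blow_up[OF X.G])
  qed
  have "cut_sign Y.B = - cut_sign X.B" if t: "trivalent X.B"
  proof -
    let ?pre = "white G # cyc G (start G)"
    have "X.other_blocks = Y.other_blocks" by (simp only: X.other_blocks_def Y.other_blocks_def)
    define s1 where "s1 = ?pre @ [v, X.e, z, w, X.u, X.e', x, y] @ X.other_blocks"
    define s2 where "s2 = ?pre @ [v, X.e, w, x, X.u, X.e', y, z] @ X.other_blocks"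
    have 1: "rearr 1 s1 (cut_orientation X.B)" "rearr 1 s2 (cut_orientation Y.B)"
      using X.cut_orientation_B Y.cut_orientation_B t tri \<open>X.other_blocks = Y.other_blocks\<close>
      by (simp_all add: s1_def s2_def)
    have 2: "rearr (- 1) s1 s2"
      unfolding s1_def s2_def by (intro rearr_context rearr_opposite_blow_ups)
    have "hedges_at X.B t \<noteq> {}" if "t \<in> black X.B" for t
    proof -
      have "card (hedges_at X.B t) = 3" using t that by (simp add: trivalent_def)
      then show ?thesis by auto
    qed
    then have "distinct (cut_orientation X.B)"
      by (rule cut_orientation_distinct(1)[OF X.ribbon_B])
    then have d: "distinct s1" using rearr_mset[OF 1(1)] by (metis mset_eq_imp_distinct_iff)
    then have d2: "distinct s2" using rearr_mset[OF 2] by (metis mset_eq_imp_distinct_iff)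
    have "list_sign (cut_orientation Y.B) = - list_sign (cut_orientation X.B)"
      using list_sign_rearr[OF 1(1) d] list_sign_rearr[OF 1(2) d2] list_sign_rearr[OF 2 d] by simp
    then show ?thesis by (simp add: cut_sign_def blow_up_simps X.src)
  qed
  then show ?thesis
    by (simp add: cut_op_eq[OF X.ribbon_B] cut_op_eq[OF Y.ribbon_B] tri
      X.state_sum_B[OF labs] Y.state_sum_B[OF labs] scale_minus_left)
qed

section \<open>The action on classes of Sullivan diagrams\<close>

lemma act_word_singleton: "length u = 1 \<Longrightarrow> act_word G u = cut_op G u"
  by (simp add: act_word_def)

lemma lin_ext_act_word:
  assumes "c \<in> hoch_chains 0"
  shows "lin_ext (act_word G) c = lin_ext (cut_op G) c"
  unfolding lin_ext_def using assms
  by (intro sum.cong arg_cong[of _ _ "scale _"] act_word_singleton) (auto simp: hoch_chains_def)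

lemma lin_ext_scaled:
  assumes "\<And>w. f w = scale r (f' w)"
  shows "lin_ext f c = scale r (lin_ext f' c)"
  unfolding lin_ext_def assms by (simp add: scale_sum mult.commute)

lemma lin_ext_zero: "(\<And>w. f w = 0) \<Longrightarrow> lin_ext f c = 0"
  by (simp add: lin_ext_def)

text \<open>
  By \<open>trivalent_blow_up_imp\<close> only blow-ups at v can contribute, and only if v has valence four.
  The two pairs of consecutive half-edges which avoid the least half-edge m are the first two and the
  last two of the other three, and the operations of these two blow-ups cancel.
\<close>

lemma bw_diff_kills:
  fixes c :: "nat list \<Rightarrow>\<^sub>0 'r::comm_ring_1"
  assumes bw: "bw_graph n G" and v: "v \<in> black G" "card (hedges_at G v) \<ge> 4"
    and c: "c \<in> hoch_chains 0"
  shows "act_chain (bw_diff G) c = 0"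
proof -
  have G: "ribbon G" using bw by (rule ribbon_if_bw_graph)
  define contrib where "contrib = (\<lambda>(h, p). scale (of_int (blow_up_sign G h)) (lin_ext (cut_op (blow_up G h p)) c))"
  let ?D = "blow_up_data G"
  have act: "act_chain (bw_diff G) c = sum contrib ?D"
    unfolding bw_diff_def act_chain_sum
    by (intro sum.cong) (auto simp: contrib_def act_chain_single lin_ext_act_word[OF c])
  have zero: "contrib (h, p) = 0" if "\<not> trivalent (blow_up G h p)" for h p
  proof -
    have "cut_op (blow_up G h p) u = (0 :: nat list \<Rightarrow>\<^sub>0 'r)" for u
      using that by (auto simp: cut_op_def trivalent_def)
    then show ?thesis by (simp add: contrib_def lin_ext_zero)
  qed
  show ?thesis
  proof (cases "card (hedges_at G v) = 4")
    case False
    then have "contrib d = 0" if "d \<in> ?D" for d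
      using that zero trivalent_blow_up_imp[OF G _ v] by (cases d) blast
    then show ?thesis unfolding act by (intro sum.neutral) blast
  next
    case True
    define m where "m = Min (hedges_at G v)"
    have m: "m \<in> hedges_at G v"
      unfolding m_def using True by (intro Min_in) (auto intro: card_ge_0_finite)
    then have mG: "m \<in> hedges G" "src G m = v" by (auto simp: hedges_at_def)
    define x y z where "x = nxt G m" and "y = nxt G x" and "z = nxt G y"
    have cyc: "cyc G m = [m, x, y, z]"
      by (simp add: cyc_def mG True x_def y_def z_def numeral_eq_Suc)
    have "distinct (cyc G m)" "set (cyc G m) = hedges_at G v" "nxt G (last (cyc G m)) = m"
      using G mG by (auto simp: ribbon_def)
    then have at: "hedges_at G v = {x, y, z, m}" and dist: "distinct [x, y, z, m]"
      and nz: "nxt G z = m"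
      unfolding cyc by auto
    have fv: "four_valent G v x y z m"
      using G v at dist nz by unfold_locales (auto simp: x_def y_def z_def)
    interpret X: four_valent G v x y z m by (rule fv)
    interpret Y: four_valent G v y z m x
      using X.G X.v X.at X.dist X.nxt by unfold_locales auto
    have take: "take 2 (cyc G h) = [h, nxt G h]" if "h \<in> hedges_at G v" for h
      using that True by (auto simp: cyc_def numeral_eq_Suc hedges_at_def)
    have "v \<noteq> white G" using v by (simp add: black_def)
    have D: "(h, 2) \<in> ?D \<longleftrightarrow> h \<in> {x, y}" if h: "h \<in> hedges_at G v" for h
    proof -
      have "h \<in> hedges G" "src G h = v" using h by (auto simp: hedges_at_def)
      then have "(h, 2) \<in> ?D \<longleftrightarrow> m \<noteq> h \<and> m \<noteq> nxt G h"
        using \<open>v \<noteq> white G\<close> True take[OF h] by (simp add: blow_up_data_def m_def)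
      moreover have "h = x \<or> h = y \<or> h = z \<or> h = m" using h at by auto
      ultimately show ?thesis using dist X.nxt by (elim disjE) simp_all
    qed
    have "sum contrib ?D = sum contrib {(x, 2), (y, 2)}"
    proof (rule sum.mono_neutral_right)
      have "?D \<subseteq> hedges G \<times> {..card (hedges G)}"
      proof
        fix d assume "d \<in> ?D"
        have "card (hedges_at G t) \<le> card (hedges G)" for t
          using G by (intro card_mono) (auto simp: ribbon_def hedges_at_def)
        moreover obtain h p where "d = (h, p)" by (cases d)
        moreover from this \<open>d \<in> ?D\<close> have "h \<in> hedges G" "p \<le> card (hedges_at G (src G h))"
          by (simp_all add: blow_up_data_def split: if_splits)
        ultimately show "d \<in> hedges G \<times> {..card (hedges G)}"
          using order_trans by auto
      qed
      then show "finite ?D" using G by (auto simp: ribbon_def intro: finite_subset)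
      show "{(x, 2), (y, 2)} \<subseteq> ?D" using D at by auto
      show "\<forall>d\<in>?D - {(x, 2), (y, 2)}. contrib d = 0"
      proof
        fix d assume d: "d \<in> ?D - {(x, 2), (y, 2)}"
        obtain h p where hp: "d = (h, p)" by (cases d)
        have "\<not> trivalent (blow_up G h p)"
        proof
          assume t: "trivalent (blow_up G h p)"
          have "(h, p) \<in> ?D" using d hp by simp
          from trivalent_blow_up_imp[OF G this v t] this have "h \<in> hedges_at G v" "p = 2"
            by (auto simp: hedges_at_def blow_up_data_def)
          with D d hp show False by auto
        qed
        then show "contrib d = 0" using hp zero by simp
      qed
    qed
    also have "\<dots> = contrib (x, 2) + contrib (y, 2)" using dist by simp
    also have "\<dots> = 0"
    proof -
      have "set (labs G) \<subseteq> hedges G" using bw by (auto simp: bw_graph_def)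
      then have "lin_ext (cut_op (blow_up G y 2)) c = scale (- 1) (lin_ext (cut_op (blow_up G x 2)) c)"
        by (intro lin_ext_scaled) (simp add: cut_op_opposite_blow_ups[OF fv] scale_minus_left)
      then show ?thesis
        by (simp add: contrib_def blow_up_sign_def X.src scale_minus_left scale_minus_right)
    qed
    finally show ?thesis unfolding act .
  qed
qed

text \<open>
  Chains of degree 0 see only the operations of the open graphs, to which the preceding invariance
  results apply relation by relation.
\<close>

lemma act_chain_sd_rel:
  fixes c :: "nat list \<Rightarrow>\<^sub>0 'r::comm_ring_1"
  assumes "r \<in> sd_rel n" and c: "c \<in> hoch_chains 0"
  shows "act_chain r c = 0"
  using assms(1)
proof (induction rule: sd_rel.induct)
  case (iso G G')
  then have "bw_graph n G" by (simp add: sd_diagram_def)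
  then have "cut_op G' = (cut_op G :: nat list \<Rightarrow> nat list \<Rightarrow>\<^sub>0 'r)"
    using bw_iso_cut_op[OF _ iso(2)] by (intro ext)
  then show ?case
    by (simp add: act_chain_diff act_chain_single lin_ext_act_word[OF c])
next
  case (orientation G xs)
  then have "ribbon G" by (auto simp: sd_diagram_def intro: ribbon_if_bw_graph)
  from lin_ext_scaled[OF orient_cut_op[OF this, of xs]]
  have "lin_ext (cut_op (G\<lparr>orient := xs\<rparr>)) c =
      scale (of_int (list_sign (orient G) * list_sign xs)) (lin_ext (cut_op G) c)" .
  moreover have "(list_sign (orient G) * list_sign xs) * (list_sign (orient G) * list_sign xs) = 1"
    using list_sign_square[of "orient G"] list_sign_square[of xs] by algebra
  ultimately show ?case
    by (simp add: act_chain_diff act_chain_single lin_ext_act_word[OF c] flip: of_int_mult)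
next
  case (high_valence G v)
  then have "cut_op G u = (0 :: nat list \<Rightarrow>\<^sub>0 'r)" for u by (auto simp: cut_op_def)
  then show ?case
    by (simp add: act_chain_single lin_ext_act_word[OF c] lin_ext_zero)
next
  case (high_valence_boundary G v)
  then show ?case using c by (intro bw_diff_kills) (auto simp: sd_diagram_def)
qed (simp_all add: act_chain_diff)

text \<open>
  Since the relations act as zero, the action takes a single value on the representatives of
  a class, and the chosen element of the set of values is this one.
\<close>

lemma sd_action_single:
  fixes c :: "nat list \<Rightarrow>\<^sub>0 'r::comm_ring_1"
  assumes "c \<in> hoch_chains 0"
  shows "sd_action (sd_class n (Poly_Mapping.single G 1)) c = lin_ext (cut_op G) c"
proof -
  have "act_chain (Poly_Mapping.single G 1 + r) c = lin_ext (cut_op G) c" if "r \<in> sd_rel n" for r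
    using assms that by (simp add: act_chain_add act_chain_sd_rel act_chain_single lin_ext_act_word)
  then have "(\<lambda>T. act_chain T c) ` sd_class n (Poly_Mapping.single G 1) = {lin_ext (cut_op G) c}"
    using sd_rel.zero[of n] by (force simp: sd_class_def)
  then show ?thesis by (simp add: sd_action_def)
qed

section \<open>Binary trees\<close>

lemma legs_pos: "0 < legs t"
  by (induction t) auto

text \<open>
  The half-edges of the n forks whose vertices are b, b + 4, b + 8, and so on.
\<close>

definition fork_half_edges :: "nat \<Rightarrow> nat \<Rightarrow> nat set" where
  "fork_half_edges b n = {b + 4 * i + j | i j. i < n \<and> j \<in> {1, 2, 3}}"

lemma fork_half_edges_0 [simp]: "fork_half_edges b 0 = {}"
  by (simp add: fork_half_edges_def)

lemma fork_half_edges_add: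
  "fork_half_edges b (m + n) = fork_half_edges b m \<union> fork_half_edges (b + 4 * m) n"
proof (rule set_eqI, rule iffI)
  fix x assume "x \<in> fork_half_edges b (m + n)"
  then obtain i j where ij: "x = b + 4 * i + j" "i < m + n" "j \<in> {1, 2, 3}"
    unfolding fork_half_edges_def by blast
  show "x \<in> fork_half_edges b m \<union> fork_half_edges (b + 4 * m) n"
  proof (cases "i < m")
    case True with ij show ?thesis unfolding fork_half_edges_def by blast
  next
    case False
    then have "x = b + 4 * m + 4 * (i - m) + j" "i - m < n" using ij by auto
    with ij show ?thesis unfolding fork_half_edges_def by blast
  qed
next
  fix x assume "x \<in> fork_half_edges b m \<union> fork_half_edges (b + 4 * m) n"
  then show "x \<in> fork_half_edges b (m + n)"
  proof
    assume "x \<in> fork_half_edges b m"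
    then show ?thesis unfolding fork_half_edges_def by force
  next
    assume "x \<in> fork_half_edges (b + 4 * m) n"
    then obtain i j where "x = b + 4 * (m + i) + j" "j \<in> {1, 2, 3}" "i < n"
      unfolding fork_half_edges_def by (auto simp: algebra_simps)
    moreover have "m + i < m + n" using \<open>i < n\<close> by simp
    ultimately show ?thesis unfolding fork_half_edges_def by blast
  qed
qed

lemma fork_half_edges_Suc:
  "fork_half_edges b (Suc n) = {b + 1, b + 2, b + 3} \<union> fork_half_edges (b + 4) n"
proof -
  have "fork_half_edges b 1 = {b + 1, b + 2, b + 3}" by (auto simp: fork_half_edges_def)
  then show ?thesis using fork_half_edges_add[of b 1 n] by simp
qed

text \<open>
  The list of endpoints with multiplicities: it is distinct iff no half-edge lies on two edges of the list and no
  edge of the list joins a half-edge to itself.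
\<close>

definition ends :: "(nat \<times> nat) list \<Rightarrow> nat list" where
  "ends E = map fst E @ map snd E"

lemma set_ends_append [simp]: "set (ends (E @ E')) = set (ends E) \<union> set (ends E')"
  by (auto simp: ends_def)

lemma set_ends_Cons [simp]: "set (ends ((x, y) # E)) = {x, y} \<union> set (ends E)"
  by (auto simp: ends_def)

lemma length_ends [simp]: "length (ends E) = 2 * length E"
  by (simp add: ends_def)

lemma length_tree_edges: "length (tree_edges t p b hs) = 2 * legs t - 1"
proof (induction t arbitrary: p b hs)
  case (Fork l r)
  then show ?case using legs_pos[of l] legs_pos[of r] by simp
qed simp

lemma ends_tree_edges:
  "length hs = legs t \<Longrightarrow>
    set (ends (tree_edges t p b hs)) = insert p (set hs \<union> fork_half_edges b (legs t - 1))"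
proof (induction t arbitrary: p b hs)
  case Leg
  then show ?case by (cases hs) (auto simp: ends_def)
next
  case (Fork l r)
  have l: "set (ends (tree_edges l p b (take (legs l) hs))) =
      insert p (set (take (legs l) hs) \<union> fork_half_edges b (legs l - 1))" for p b
    using Fork.prems by (intro Fork.IH) simp
  have r: "set (ends (tree_edges r p b (drop (legs l) hs))) =
      insert p (set (drop (legs l) hs) \<union> fork_half_edges b (legs r - 1))" for p b
    using Fork.prems by (intro Fork.IH) simp
  have hs: "set hs = set (take (legs l) hs) \<union> set (drop (legs l) hs)"
    by (metis append_take_drop_id set_append)
  have "legs (Fork l r) - 1 = Suc ((legs l - 1) + (legs r - 1))"
    using legs_pos[of l] legs_pos[of r] by simp
  moreover have "b + 4 + 4 * (legs l - 1) = b + 4 * legs l"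
    using legs_pos[of l] by simp
  ultimately have "fork_half_edges b (legs (Fork l r) - 1) = {b + 1, b + 2, b + 3} \<union>
      fork_half_edges (b + 4) (legs l - 1) \<union> fork_half_edges (b + 4 * legs l) (legs r - 1)"
    by (simp only: fork_half_edges_Suc fork_half_edges_add Un_assoc)
  then show ?case by (simp only: tree_edges.simps set_ends_Cons set_ends_append l r hs) blast
qed

text \<open>
  A fork with m and n forks in its subtrees numbers itself first, then those of the left subtree, and then
  those of the right one.
\<close>

lemma all_less_forkI:
  fixes P :: "nat \<Rightarrow> bool"
  assumes "P 0" "\<And>i. i < m \<Longrightarrow> P (i + 1)" "\<And>i. i < n \<Longrightarrow> P (i + (m + 1))"
  shows "i < m + n + 1 \<Longrightarrow> P i"
proof -
  assume i: "i < m + n + 1"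
  consider "i = 0" | "0 < i" "i < m + 1" | "m + 1 \<le> i"
    by (cases "i = 0"; cases "i < m + 1") auto
  then show "P i"
  proof cases
    case 2 then show ?thesis using assms(2)[of "i - 1"] by simp
  next
    case 3 then show ?thesis using assms(3)[of "i - (m + 1)"] i by simp
  qed (simp add: assms(1))
qed

text \<open>
  From the legs towards the root: a leg labelled 1 forces 0 on the half-edge to which it is
  joined; two labels 0 above a fork force 1 below it, by balance at its vertex, and then 0 at the other end
  of the edge below.
\<close>

lemma tree_forced:
  fixes c :: "nat \<Rightarrow> nat"
  assumes "length hs = legs t" "\<And>h. h \<in> set hs \<Longrightarrow> c h = 1"
    and "\<And>x y. (x, y) \<in> set (tree_edges t p b hs) \<Longrightarrow> c x + c y = 1"
    and "\<And>i. i < legs t - 1 \<Longrightarrow> c (b + 4 * i + 1) + c (b + 4 * i + 2) + c (b + 4 * i + 3) = 1"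
  shows "c p = 0 \<and>
    (\<forall>i < legs t - 1. c (b + 4 * i + 1) = 1 \<and> c (b + 4 * i + 2) = 0 \<and> c (b + 4 * i + 3) = 0)"
  using assms
proof (induction t arbitrary: p b hs)
  case Leg
  then have "hd hs \<in> set hs" by (cases hs) auto
  with Leg show ?case by force
next
  case (Fork l r)
  let ?m = "legs l - 1" and ?n = "legs r - 1"
  have leg: "legs (Fork l r) - 1 = ?m + ?n + 1" "4 * legs l = 4 * ?m + 4"
    using legs_pos[of l] legs_pos[of r] by auto
  have hs: "set (take (legs l) hs) \<subseteq> set hs" "set (drop (legs l) hs) \<subseteq> set hs"
    by (rule set_take_subset, rule set_drop_subset)
  let ?P = "\<lambda>i. c (b + 4 * i + 1) + c (b + 4 * i + 2) + c (b + 4 * i + 3) = 1"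
  have P: "?P 0" "\<And>i. i < ?m \<Longrightarrow> ?P (i + 1)" "\<And>i. i < ?n \<Longrightarrow> ?P (i + (?m + 1))"
    by (rule Fork.prems(4)[unfolded leg], simp)+
  have L: "c (b + 2) = 0 \<and> (\<forall>i < ?m. c (b + 4 + 4 * i + 1) = 1 \<and> c (b + 4 + 4 * i + 2) = 0 \<and>
      c (b + 4 + 4 * i + 3) = 0)"
    using Fork.prems(1-3) hs P(2) by (intro Fork.IH(1)[of "take (legs l) hs"]) (auto simp: algebra_simps)
  have R: "c (b + 3) = 0 \<and> (\<forall>i < ?n. c (b + 4 * legs l + 4 * i + 1) = 1 \<and>
      c (b + 4 * legs l + 4 * i + 2) = 0 \<and> c (b + 4 * legs l + 4 * i + 3) = 0)"
    using Fork.prems(1-3) hs P(3) leg(2)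
    by (intro Fork.IH(2)[of "drop (legs l) hs"]) (auto simp: algebra_simps)
  have 1: "c (b + 1) = 1" using P(1) L R by simp
  have "c p + c (b + 1) = 1" using Fork.prems(3) by simp
  then have "c p = 0" using 1 by simp
  moreover have "c (b + 4 * i + 1) = 1 \<and> c (b + 4 * i + 2) = 0 \<and> c (b + 4 * i + 3) = 0"
    if "i < ?m + ?n + 1" for i
    using that
  proof (rule all_less_forkI[rotated -1])
    show "c (b + 4 * 0 + 1) = 1 \<and> c (b + 4 * 0 + 2) = 0 \<and> c (b + 4 * 0 + 3) = 0"
      using 1 L R by simp
  next
    fix i assume "i < ?m"
    then show "c (b + 4 * (i + 1) + 1) = 1 \<and> c (b + 4 * (i + 1) + 2) = 0 \<and> c (b + 4 * (i + 1) + 3) = 0"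
      using L by (simp add: algebra_simps)
  next
    fix i assume "i < ?n"
    then show "c (b + 4 * (i + (?m + 1)) + 1) = 1 \<and> c (b + 4 * (i + (?m + 1)) + 2) = 0 \<and>
        c (b + 4 * (i + (?m + 1)) + 3) = 0"
      using R leg(2) by (simp add: algebra_simps)
  qed
  ultimately show ?case unfolding leg by blast
qed

text \<open>
  Conversely, these labels are consistent: every edge joins a half-edge labelled 0, which points towards
  the legs, to a half-edge labelled 1, which points towards the root or is a leg.
\<close>

lemma tree_balanced:
  fixes c :: "nat \<Rightarrow> nat"
  assumes "length hs = legs t" "\<And>h. h \<in> set hs \<Longrightarrow> c h = 1" "c p = 0"
    and "\<And>i. i < legs t - 1 \<Longrightarrow> c (b + 4 * i + 1) = 1 \<and> c (b + 4 * i + 2) = 0 \<and> c (b + 4 * i + 3) = 0"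
  shows "(x, y) \<in> set (tree_edges t p b hs) \<Longrightarrow> c x + c y = 1"
  using assms
proof (induction t arbitrary: p b hs)
  case Leg
  then have "hd hs \<in> set hs" by (cases hs) auto
  with Leg show ?case by force
next
  case (Fork l r)
  let ?m = "legs l - 1" and ?n = "legs r - 1"
  have leg: "legs (Fork l r) - 1 = ?m + ?n + 1" "4 * legs l = 4 * ?m + 4"
    using legs_pos[of l] legs_pos[of r] by auto
  have hs: "set (take (legs l) hs) \<subseteq> set hs" "set (drop (legs l) hs) \<subseteq> set hs"
    by (rule set_take_subset, rule set_drop_subset)
  let ?P = "\<lambda>i. c (b + 4 * i + 1) = 1 \<and> c (b + 4 * i + 2) = 0 \<and> c (b + 4 * i + 3) = 0"
  have P: "?P 0" "\<And>i. i < ?m \<Longrightarrow> ?P (i + 1)" "\<And>i. i < ?n \<Longrightarrow> ?P (i + (?m + 1))"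
    by (rule Fork.prems(5)[unfolded leg], simp)+
  have P1: "c (b + 1) = 1" "c (b + 2) = 0" "c (b + 3) = 0" using P(1) by simp_all
  consider "(x, y) = (p, b + 1)" | "(x, y) \<in> set (tree_edges l (b + 2) (b + 4) (take (legs l) hs))"
    | "(x, y) \<in> set (tree_edges r (b + 3) (b + 4 * legs l) (drop (legs l) hs))"
    using Fork.prems(1) by auto
  then show ?case
  proof cases
    case 1 then show ?thesis using Fork.prems(4) P1 by simp
  next
    case 2 then show ?thesis
    proof (rule Fork.IH(1))
      show "c (b + 4 + 4 * i + 1) = 1 \<and> c (b + 4 + 4 * i + 2) = 0 \<and> c (b + 4 + 4 * i + 3) = 0"
        if "i < ?m" for i using P(2)[OF that] by (simp add: algebra_simps)
    qed (use Fork.prems hs P1 in auto)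
  next
    case 3 then show ?thesis
    proof (rule Fork.IH(2))
      show "c (b + 4 * legs l + 4 * i + 1) = 1 \<and> c (b + 4 * legs l + 4 * i + 2) = 0 \<and>
          c (b + 4 * legs l + 4 * i + 3) = 0"
        if "i < ?n" for i using P(3)[OF that] leg(2) by (simp add: algebra_simps)
    qed (use Fork.prems hs P1 in auto)
  qed
qed

section \<open>The diagram made of two trees\<close>

text \<open>
  The names k, b1, b2, N are those of the definition of \<open>t_graph\<close>, with N the number of all vertices and
  half-edges.
\<close>

locale two_trees =
  fixes T1 T2 :: btree and g k b1 b2 N :: nat
  assumes g: "g \<ge> 1" and legs1: "legs T1 = g" and legs2: "legs T2 = g + 1"
  defines "k \<equiv> 2 * g + 2" and "b1 \<equiv> 2 * g + 3" and "b2 \<equiv> 2 * g + 3 + 4 * (g - 1)"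
    and "N \<equiv> 10 * g - 1"
begin

abbreviation "G \<equiv> t_graph T1 T2"
abbreviation "V \<equiv> insert 0 {b1 + 4 * i | i. i < 2 * g - 1}"
abbreviation "odds \<equiv> map (\<lambda>i. 2 * i + 1) (rev [1..<g + 1])"
abbreviation "evens \<equiv> map (\<lambda>i. 2 * i) (rev [1..<g + 2])"
definition "E1 = tree_edges T1 1 b1 odds"
text \<open>
  The first entry removed here is the root of the second tree, the incoming leaf, which
  \<open>tree_edges\<close> lists as an edge from \<open>b2 + 1\<close> to itself.
\<close>

definition "E2 = tl (tree_edges T2 (b2 + 1) b2 evens)"

lemma T2_Fork:
  obtains l r where "T2 = Fork l r" "legs l + legs r = g + 1"
    "tree_edges T2 (b2 + 1) b2 evens = (b2 + 1, b2 + 1) # E2"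
    "E2 = tree_edges l (b2 + 2) (b2 + 4) (take (legs l) evens) @
      tree_edges r (b2 + 3) (b2 + 4 * legs l) (drop (legs l) evens)"
proof (cases T2)
  case Leg
  then show ?thesis using legs2 g by simp
next
  case (Fork l r)
  have e2: "E2 = tree_edges l (b2 + 2) (b2 + 4) (take (legs l) evens) @
      tree_edges r (b2 + 3) (b2 + 4 * legs l) (drop (legs l) evens)"
    unfolding E2_def unfolding Fork tree_edges.simps list.sel by (rule HOL.refl)
  show ?thesis
  proof (rule that[OF Fork _ _ e2])
    show "legs l + legs r = g + 1" using legs2 Fork by simp
    show "tree_edges T2 (b2 + 1) b2 evens = (b2 + 1, b2 + 1) # E2"
      unfolding e2 unfolding Fork tree_edges.simps by (rule HOL.refl)
  qed
qed

lemma fields: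
  "verts G = V" "hedges G = {0..<N} - V"
  "src G = (\<lambda>h. if h \<le> k then 0 else h - (h - b1) mod 4)"
  "nxt G = (\<lambda>h. if h \<le> k then (if h = k then 1 else h + 1)
     else if (h - b1) mod 4 = 3 then h - 2 else h + 1)"
  "white G = 0" "start G = 1" "labs G = [b2 + 1]" "orient G = [0..<N]"
  "opp G = (\<lambda>h. the (map_of ((E1 @ (b2 + 1, b2 + 1) # E2) @
     map prod.swap (E1 @ (b2 + 1, b2 + 1) # E2)) h))"
proof -
  have e: "tree_edges T2 (b2 + 1) b2 evens = (b2 + 1, b2 + 1) # E2"
    using T2_Fork by metis
  have G: "G = \<lparr> verts = V, hedges = {0..<N} - V,
           src = (\<lambda>h. if h \<le> k then 0 else h - (h - b1) mod 4),
           opp = (\<lambda>h. the (map_of ((E1 @ (b2 + 1, b2 + 1) # E2) @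
             map prod.swap (E1 @ (b2 + 1, b2 + 1) # E2)) h)),
           nxt = (\<lambda>h. if h \<le> k then (if h = k then 1 else h + 1)
                       else if (h - b1) mod 4 = 3 then h - 2 else h + 1),
           white = 0, start = 1, labs = [b2 + 1], orient = [0..<N] \<rparr>"
  proof -
    have c: "2 * g + 2 = k" "k + 1 = b1" "b1 + 4 * (g - 1) = b2" "10 * g - 1 = N"
      by (simp_all add: k_def b1_def b2_def N_def)
    show ?thesis
      unfolding e[symmetric] E1_def t_graph_def Let_def legs1 c by (simp only:)
  qed
  show "verts G = V" "hedges G = {0..<N} - V"
  "src G = (\<lambda>h. if h \<le> k then 0 else h - (h - b1) mod 4)"
  "nxt G = (\<lambda>h. if h \<le> k then (if h = k then 1 else h + 1)
     else if (h - b1) mod 4 = 3 then h - 2 else h + 1)"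
  "white G = 0" "start G = 1" "labs G = [b2 + 1]" "orient G = [0..<N]"
  "opp G = (\<lambda>h. the (map_of ((E1 @ (b2 + 1, b2 + 1) # E2) @
     map prod.swap (E1 @ (b2 + 1, b2 + 1) # E2)) h))"
    unfolding G by simp_all
qed

lemma b1_k: "b1 = k + 1" by (simp add: b1_def k_def)

lemma N_eq: "N = b1 + 4 * (2 * g - 1)"
  using g by (simp add: N_def b1_def)

lemma b2_eq: "b2 = b1 + 4 * (g - 1)"
  by (simp add: b2_def b1_def)

lemma hedges_eq: "hedges G = {1..k} \<union> fork_half_edges b1 (2 * g - 1)"
proof (rule set_eqI)
  fix x
  consider "x \<le> k" | "b1 \<le> x" "x < N" | "N \<le> x" unfolding b1_k by linarith
  then show "x \<in> hedges G \<longleftrightarrow> x \<in> {1..k} \<union> fork_half_edges b1 (2 * g - 1)"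
  proof cases
    case 1
    then show ?thesis by (auto simp: fields fork_half_edges_def b1_k N_eq)
  next
    case 2
    define i j where "i = (x - b1) div 4" and "j = (x - b1) mod 4"
    have x: "x = b1 + 4 * i + j" "j < 4" using 2 by (auto simp: i_def j_def)
    then have i: "i < 2 * g - 1" using 2 N_eq by linarith
    have "x \<in> V \<longleftrightarrow> j = 0"
    proof
      assume "x \<in> V"
      then obtain i' where "x = b1 + 4 * i'" using 2 b1_k by auto
      then show "j = 0" by (simp add: j_def)
    qed (use x i in auto)
    moreover have "x \<in> fork_half_edges b1 (2 * g - 1) \<longleftrightarrow> j \<in> {1, 2, 3}"
    proof
      assume "x \<in> fork_half_edges b1 (2 * g - 1)"
      then obtain i' j' where "x = b1 + 4 * i' + j'" "j' \<in> {1, 2, 3}"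
        by (auto simp: fork_half_edges_def)
      then show "j \<in> {1, 2, 3}" by (auto simp: j_def)
    qed (use x i in \<open>unfold fork_half_edges_def, blast\<close>)
    moreover have "x \<notin> {1..k}" using 2 b1_k by auto
    ultimately show ?thesis using 2 x by (auto simp: fields(2))
  next
    case 3
    then show ?thesis by (auto simp: fields fork_half_edges_def b1_k N_eq)
  qed
qed

lemma fork_fields:
  "src G (b1 + 4 * i + 1) = b1 + 4 * i" "src G (b1 + 4 * i + 2) = b1 + 4 * i"
  "src G (b1 + 4 * i + 3) = b1 + 4 * i"
  "nxt G (b1 + 4 * i + 1) = b1 + 4 * i + 2" "nxt G (b1 + 4 * i + 2) = b1 + 4 * i + 3"
  "nxt G (b1 + 4 * i + 3) = b1 + 4 * i + 1"
proof -
  have *: "src G (b1 + 4 * i + j) = b1 + 4 * i"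
    "nxt G (b1 + 4 * i + j) = (if j = 3 then b1 + 4 * i + j - 2 else b1 + 4 * i + j + 1)"
    if "j < 4" for j
  proof -
    have "b1 + 4 * i + j - b1 = j + 4 * i" by simp
    then have m: "(b1 + 4 * i + j - b1) mod 4 = j" using that by (simp only: mod_mult_self2) simp
    have n: "\<not> b1 + 4 * i + j \<le> k" by (simp add: b1_k)
    show "src G (b1 + 4 * i + j) = b1 + 4 * i"
      "nxt G (b1 + 4 * i + j) = (if j = 3 then b1 + 4 * i + j - 2 else b1 + 4 * i + j + 1)"
      unfolding fields(3,4) m using n by simp_all
  qed
  from *[of 1] *[of 2] *[of 3] show
    "src G (b1 + 4 * i + 1) = b1 + 4 * i" "src G (b1 + 4 * i + 2) = b1 + 4 * i"
    "src G (b1 + 4 * i + 3) = b1 + 4 * i"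
    "nxt G (b1 + 4 * i + 1) = b1 + 4 * i + 2" "nxt G (b1 + 4 * i + 2) = b1 + 4 * i + 3"
    "nxt G (b1 + 4 * i + 3) = b1 + 4 * i + 1"
    by simp_all
qed

lemma hedges_cases [consumes 1, case_names white fork]:
  assumes "h \<in> hedges G"
  obtains "1 \<le> h" "h \<le> k" | i where "i < 2 * g - 1" "h \<in> {b1 + 4 * i + 1, b1 + 4 * i + 2, b1 + 4 * i + 3}"
proof -
  have "h \<in> {1..k} \<or> (\<exists>i j. h = b1 + 4 * i + j \<and> i < 2 * g - 1 \<and> j \<in> {1, 2, 3})"
    using assms by (auto simp: hedges_eq fork_half_edges_def)
  then show ?thesis using that by auto
qed

lemma src_white: "h \<le> k \<Longrightarrow> src G h = 0"
  by (simp add: fields)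

lemma hedges_at_white: "hedges_at G 0 = {1..k}"
proof (rule set_eqI, rule iffI)
  fix h assume "h \<in> hedges_at G 0"
  then have h: "h \<in> hedges G" "src G h = 0" by (auto simp: hedges_at_def)
  from h(1) show "h \<in> {1..k}"
  proof (cases rule: hedges_cases)
    case (fork i)
    then show ?thesis using h(2) fork_fields(1-3)[of i] b1_k by auto
  qed simp
qed (auto simp: hedges_at_def src_white hedges_eq)

lemma hedges_at_fork:
  assumes "i < 2 * g - 1"
  shows "hedges_at G (b1 + 4 * i) = {b1 + 4 * i + 1, b1 + 4 * i + 2, b1 + 4 * i + 3}"
proof (rule set_eqI, rule iffI)
  fix h assume "h \<in> hedges_at G (b1 + 4 * i)"
  then have h: "h \<in> hedges G" "src G h = b1 + 4 * i" by (auto simp: hedges_at_def)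
  from h(1) show "h \<in> {b1 + 4 * i + 1, b1 + 4 * i + 2, b1 + 4 * i + 3}"
  proof (cases rule: hedges_cases)
    case white
    then show ?thesis using h(2) b1_k by (simp add: src_white)
  next
    case (fork i')
    then have "src G h = b1 + 4 * i'" using fork_fields[of i'] by auto
    then show ?thesis using fork h(2) by simp
  qed
next
  fix h assume h: "h \<in> {b1 + 4 * i + 1, b1 + 4 * i + 2, b1 + 4 * i + 3}"
  then have "h \<in> hedges G" using assms unfolding hedges_eq fork_half_edges_def by blast
  moreover have "src G h = b1 + 4 * i" using h fork_fields[of i] by auto
  ultimately show "h \<in> hedges_at G (b1 + 4 * i)" by (simp add: hedges_at_def)
qed

lemma black: "black G = {b1 + 4 * i | i. i < 2 * g - 1}"
  using b1_k by (auto simp: black_def fields)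

lemma cyc_white:
  assumes "1 \<le> h" "h \<le> k"
  shows "cyc G h = [h..<Suc k] @ [1..<h]"
proof (rule nth_equalityI)
  have card: "card (hedges_at G (src G h)) = k" using assms by (simp add: src_white hedges_at_white)
  then show "length (cyc G h) = length ([h..<Suc k] @ [1..<h])" using assms by simp
  have it: "(nxt G ^^ i) h = (if h + i \<le> k then h + i else h + i - k)" if "i < k" for i
    using that
  proof (induction i)
    case 0 then show ?case using assms by simp
  next
    case (Suc i)
    then show ?case using assms by (auto simp: fields(4))
  qed
  fix i assume "i < length (cyc G h)"
  then have "i < k" using card by simp
  then show "cyc G h ! i = ([h..<Suc k] @ [1..<h]) ! i"
    using assms it[of i] by (auto simp: nth_cyc card nth_append)
qed

lemma cyc_fork:
  assumes "i < 2 * g - 1"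
  shows "cyc G (b1 + 4 * i + 1) = [b1 + 4 * i + 1, b1 + 4 * i + 2, b1 + 4 * i + 3]"
    and "cyc G (b1 + 4 * i + 2) = [b1 + 4 * i + 2, b1 + 4 * i + 3, b1 + 4 * i + 1]"
    and "cyc G (b1 + 4 * i + 3) = [b1 + 4 * i + 3, b1 + 4 * i + 1, b1 + 4 * i + 2]"
proof -
  have *: "cyc G h = [h, nxt G h, nxt G (nxt G h)]" if "src G h = b1 + 4 * i" for h
    using that hedges_at_fork[OF assms] by (simp add: cyc_def numeral_3_eq_3)
  show "cyc G (b1 + 4 * i + 1) = [b1 + 4 * i + 1, b1 + 4 * i + 2, b1 + 4 * i + 3]"
    "cyc G (b1 + 4 * i + 2) = [b1 + 4 * i + 2, b1 + 4 * i + 3, b1 + 4 * i + 1]"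
    "cyc G (b1 + 4 * i + 3) = [b1 + 4 * i + 3, b1 + 4 * i + 1, b1 + 4 * i + 2]"
    using *[of "b1 + 4 * i + 1"] *[of "b1 + 4 * i + 2"] *[of "b1 + 4 * i + 3"]
    by (simp_all only: fork_fields)
qed

definition "edges = set (E1 @ E2) \<union> prod.swap ` set (E1 @ E2)"

lemma set_odds_evens: "set odds \<union> set evens = {2..k}"
proof (rule set_eqI)
  fix x
  show "x \<in> set odds \<union> set evens \<longleftrightarrow> x \<in> {2..k}"
  proof (cases "even x")
    case True
    then obtain y where x: "x = 2 * y" by (auto elim: evenE)
    have "x \<in> set evens \<longleftrightarrow> y \<in> {1..<g + 2}" unfolding x by (auto simp del: upt_Suc)
    moreover have "x \<notin> set odds" using True by (auto simp del: upt_Suc)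
    moreover have "x \<in> {2..k} \<longleftrightarrow> y \<in> {1..<g + 2}" unfolding x by (auto simp: k_def)
    ultimately show ?thesis by blast
  next
    case False
    then obtain y where x: "x = 2 * y + 1" by (auto elim: oddE)
    have "x \<in> set odds \<longleftrightarrow> y \<in> {1..<g + 1}" unfolding x by (auto simp del: upt_Suc)
    moreover have "x \<notin> set evens" using False by (auto simp del: upt_Suc)
    moreover have "x \<in> {2..k} \<longleftrightarrow> y \<in> {1..<g + 1}" unfolding x by (auto simp: k_def)
    ultimately show ?thesis by blast
  qed
qed

lemma root_in_hedges: "b2 + 1 \<in> hedges G"
proof -
  have "b2 + 1 = b1 + 4 * (g - 1) + 1" "g - 1 < 2 * g - 1" using g by (auto simp: b2_eq)
  then show ?thesis unfolding hedges_eq fork_half_edges_def by blast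
qed

text \<open>
  That no half-edge is used twice follows by counting: the endpoints of the edges exhaust the 8g - 2
  half-edges other than the incoming leaf, and there are only 4g - 1 edges.
\<close>

lemma ends_edges: "set (ends (E1 @ E2)) = hedges G - {b2 + 1}" and ends_distinct: "distinct (ends (E1 @ E2))"
proof -
  obtain l r where T2: "legs l + legs r = g + 1"
    "E2 = tree_edges l (b2 + 2) (b2 + 4) (take (legs l) evens) @
      tree_edges r (b2 + 3) (b2 + 4 * legs l) (drop (legs l) evens)"
    using T2_Fork by metis
  have ev: "set evens = set (take (legs l) evens) \<union> set (drop (legs l) evens)"
    by (metis append_take_drop_id set_append)
  have len: "length evens = legs l + legs r" using T2(1) by simp
  have lr: "legs l \<ge> 1" "legs r \<ge> 1" using legs_pos[of l] legs_pos[of r] by auto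
  have "g - 1 = (legs l - 1) + (legs r - 1)" "b2 + 4 + 4 * (legs l - 1) = b2 + 4 * legs l"
    using T2(1) lr by auto
  then have F: "fork_half_edges (b2 + 4) (g - 1) =
      fork_half_edges (b2 + 4) (legs l - 1) \<union> fork_half_edges (b2 + 4 * legs l) (legs r - 1)"
    by (simp only: fork_half_edges_add)
  have "set (ends (tree_edges l (b2 + 2) (b2 + 4) (take (legs l) evens))) =
      insert (b2 + 2) (set (take (legs l) evens) \<union> fork_half_edges (b2 + 4) (legs l - 1))"
    by (intro ends_tree_edges) (simp only: length_take len min_add_distrib_left min.absorb2 le_add1)
  moreover have "set (ends (tree_edges r (b2 + 3) (b2 + 4 * legs l) (drop (legs l) evens))) =
      insert (b2 + 3) (set (drop (legs l) evens) \<union> fork_half_edges (b2 + 4 * legs l) (legs r - 1))"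
    by (intro ends_tree_edges) (simp only: length_drop len diff_add_inverse)
  ultimately have e2: "set (ends E2) = {b2 + 2, b2 + 3} \<union> set evens \<union> fork_half_edges (b2 + 4) (g - 1)"
    unfolding T2(2) set_ends_append F ev by blast
  have e1: "set (ends E1) = insert 1 (set odds \<union> fork_half_edges b1 (g - 1))"
    unfolding E1_def using legs1 ends_tree_edges[of odds T1 1 b1] by simp
  have "2 * g - 1 = (g - 1) + Suc (g - 1)" using g by simp
  then have "fork_half_edges b1 (2 * g - 1) = fork_half_edges b1 (g - 1) \<union>
      ({b2 + 1, b2 + 2, b2 + 3} \<union> fork_half_edges (b2 + 4) (g - 1))"
    by (simp only: fork_half_edges_add fork_half_edges_Suc b2_eq[symmetric])
  moreover have "{1..k} = insert 1 (set odds \<union> set evens)"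
    unfolding set_odds_evens by (auto simp: k_def)
  ultimately have "hedges G = insert 1 (set odds \<union> set evens) \<union> (fork_half_edges b1 (g - 1) \<union>
      ({b2 + 1, b2 + 2, b2 + 3} \<union> fork_half_edges (b2 + 4) (g - 1)))"
    by (simp only: hedges_eq)
  moreover have "b2 + 1 \<notin> fork_half_edges b1 (g - 1)"
    by (auto simp: fork_half_edges_def b2_eq)
  moreover have "b2 + 1 \<notin> fork_half_edges (b2 + 4) (g - 1)"
    by (auto simp: fork_half_edges_def)
  moreover have "b2 + 1 \<notin> {2..k}" "b2 + 1 \<noteq> 1" "b2 + 1 \<noteq> b2 + 2" "b2 + 1 \<noteq> b2 + 3"
    using b1_k by (simp_all add: b2_eq)
  ultimately show *: "set (ends (E1 @ E2)) = hedges G - {b2 + 1}"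
    unfolding set_ends_append e1 e2 set_odds_evens[symmetric] by blast
  have V: "card V = 2 * g"
  proof -
    have "{b1 + 4 * i | i. i < 2 * g - 1} = (\<lambda>i. b1 + 4 * i) ` {..<2 * g - 1}" by auto
    then have "card {b1 + 4 * i | i. i < 2 * g - 1} = 2 * g - 1"
      by (simp add: card_image inj_on_def)
    moreover have "0 \<notin> {b1 + 4 * i | i. i < 2 * g - 1}" using b1_k by simp
    ultimately show ?thesis using g by simp
  qed
  have "V \<subseteq> {0..<N}" using g by (auto simp: N_eq)
  then have "card (hedges G) = N - 2 * g"
    using V by (simp add: fields(2) card_Diff_subset finite_subset)
  moreover note root_in_hedges
  ultimately have "card (set (ends (E1 @ E2))) = 8 * g - 2"
    unfolding * using g by (simp add: N_def)
  moreover have "length (ends (E1 @ E2)) = 8 * g - 2"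
    using T2(1) g lr by (simp add: E1_def T2(2) length_tree_edges legs1)
  ultimately show "distinct (ends (E1 @ E2))" by (intro card_distinct) simp
qed

text \<open>
  The involution is defined by looking up the first matching entry of an association list.  As no half-edge is
  an endpoint twice, and the incoming leaf is on no proper edge, the matching entry is determined by its key.
\<close>

lemma opp_eq:
  assumes "(x, y) \<in> insert (b2 + 1, b2 + 1) edges"
  shows "opp G x = y"
proof -
  let ?L = "(E1 @ (b2 + 1, b2 + 1) # E2) @ map prod.swap (E1 @ (b2 + 1, b2 + 1) # E2)"
  let ?M = "(E1 @ E2) @ map prod.swap (E1 @ E2)"
  have set: "set ?L = insert (b2 + 1, b2 + 1) edges" "set ?M = edges" by (auto simp: edges_def)
  have fst: "map fst ?M = ends (E1 @ E2)" by (simp add: ends_def comp_def)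
  then have "distinct (map fst ?M)" using ends_distinct by simp
  then have edges: "y = y'" if "(x, y) \<in> edges" "(x, y') \<in> edges" for x y y'
    using that eq_key_imp_eq_value set(2) by metis
  have r: "(b2 + 1, y) \<notin> edges" for y
  proof
    assume "(b2 + 1, y) \<in> edges"
    then have "b2 + 1 \<in> set (map fst ?M)" unfolding set(2)[symmetric] by force
    then show False unfolding fst ends_edges by simp
  qed
  have "x \<in> fst ` set ?L" using assms unfolding set(1)[symmetric] by (rule image_eqI[rotated]) simp
  then have "map_of ?L x \<noteq> None" by (simp only: map_of_eq_None_iff not_not)
  then obtain y' where y': "map_of ?L x = Some y'" by blast
  then have "(x, y') \<in> insert (b2 + 1, b2 + 1) edges" unfolding set(1)[symmetric] by (rule map_of_SomeD)
  then have "y' = y" using assms edges r by blast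
  then show ?thesis using y' by (simp only: fields option.sel)
qed

lemma edges_sym: "(x, y) \<in> edges \<Longrightarrow> (y, x) \<in> edges"
  by (auto simp: edges_def)

lemma edges_ends: "(x, y) \<in> edges \<Longrightarrow> x \<in> hedges G \<and> y \<in> hedges G \<and> x \<noteq> y"
proof -
  assume xy: "(x, y) \<in> edges"
  have *: "x \<in> hedges G \<and> y \<in> hedges G \<and> x \<noteq> y" if "(x, y) \<in> set (E1 @ E2)" for x y
  proof -
    have "x \<in> set (map fst (E1 @ E2))" "y \<in> set (map snd (E1 @ E2))" using that by force+
    moreover have "distinct (map fst (E1 @ E2) @ map snd (E1 @ E2))"
      "set (map fst (E1 @ E2) @ map snd (E1 @ E2)) = hedges G - {b2 + 1}"
      using ends_edges ends_distinct unfolding ends_def by blast+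
    ultimately show ?thesis unfolding distinct_append set_append by blast
  qed
  show ?thesis using xy *[of x y] *[of y x] by (auto simp: edges_def)
qed

lemma edges_total: "x \<in> hedges G \<Longrightarrow> x \<noteq> b2 + 1 \<Longrightarrow> (x, opp G x) \<in> edges"
proof -
  assume "x \<in> hedges G" "x \<noteq> b2 + 1"
  then have "x \<in> set (ends (E1 @ E2))" using ends_edges by simp
  then obtain y where "(x, y) \<in> edges" unfolding ends_def edges_def by force
  then show ?thesis using opp_eq[of x y] by simp
qed

lemma opp_root: "opp G (b2 + 1) = b2 + 1"
  by (rule opp_eq) simp

lemma bw_graph: "bw_graph 1 G"
proof -
  have fin: "finite (verts G)" "finite (hedges G)" "verts G \<inter> hedges G = {}"
    by (auto simp: fields)
  have opp: "opp G h \<in> hedges G \<and> opp G (opp G h) = h" if "h \<in> hedges G" for h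
  proof (cases "h = b2 + 1")
    case True
    then show ?thesis using opp_root root_in_hedges by simp
  next
    case False
    from edges_total[OF that False] have "(h, opp G h) \<in> edges" .
    then show ?thesis using edges_ends edges_sym opp_eq by blast
  qed
  have cyc: "src G h \<in> verts G \<and> nxt G h \<in> hedges G \<and> distinct (cyc G h) \<and>
      set (cyc G h) = hedges_at G (src G h) \<and> nxt G (last (cyc G h)) = h" if "h \<in> hedges G" for h
    using that
  proof (cases rule: hedges_cases)
    case white
    have "last (cyc G h) = (if h = 1 then k else h - 1)"
      using white by (simp add: cyc_white last_append)
    moreover have "nxt G h \<in> {1..k}" using white by (auto simp: fields(4))
    ultimately show ?thesis
      using white by (auto simp: src_white hedges_at_white cyc_white fields(1,4) hedges_eq)
  next
    case (fork i)
    have v: "b1 + 4 * i \<in> verts G" using fork(1) by (auto simp: fields(1))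
    have sub: "{b1 + 4 * i + 1, b1 + 4 * i + 2, b1 + 4 * i + 3} \<subseteq> hedges G"
      using hedges_at_fork[OF fork(1)] by (auto simp: hedges_at_def)
    have "\<exists>y z. cyc G h = [h, y, z] \<and> distinct [h, y, z] \<and> nxt G h = y \<and> nxt G z = h \<and>
        {h, y, z} = {b1 + 4 * i + 1, b1 + 4 * i + 2, b1 + 4 * i + 3} \<and> src G h = b1 + 4 * i"
    proof -
      from fork(2) consider "h = b1 + 4 * i + 1" | "h = b1 + 4 * i + 2" | "h = b1 + 4 * i + 3" by blast
      then show ?thesis
      proof cases
        case 1
        show ?thesis unfolding 1 fork_fields cyc_fork[OF fork(1)]
          by (rule exI[of _ "b1 + 4 * i + 2"], rule exI[of _ "b1 + 4 * i + 3"]) (simp only: fork_fields, simp)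
      next
        case 2
        show ?thesis unfolding 2 fork_fields cyc_fork[OF fork(1)]
          by (rule exI[of _ "b1 + 4 * i + 3"], rule exI[of _ "b1 + 4 * i + 1"]) (simp only: fork_fields, auto)
      next
        case 3
        show ?thesis unfolding 3 fork_fields cyc_fork[OF fork(1)]
          by (rule exI[of _ "b1 + 4 * i + 1"], rule exI[of _ "b1 + 4 * i + 2"]) (simp only: fork_fields, auto)
      qed
    qed
    then obtain y z where c: "cyc G h = [h, y, z]" "distinct [h, y, z]" "nxt G h = y" "nxt G z = h"
        "{h, y, z} = {b1 + 4 * i + 1, b1 + 4 * i + 2, b1 + 4 * i + 3}" "src G h = b1 + 4 * i"
      by blast
    have "y \<in> hedges G" using sub c(5) by blast
    then show ?thesis unfolding c(6) hedges_at_fork[OF fork(1)] c(5)[symmetric] c(1,3)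
      using v c(2,4) by simp
  qed
  have "card (hedges_at G v) \<ge> 3" if "v \<in> black G" for v
    using that hedges_at_fork by (auto simp: black)
  moreover have "white G \<in> verts G" "start G \<in> hedges_at G (white G)"
    using g by (auto simp: fields(1,5,6) hedges_at_white k_def)
  moreover have "{h \<in> hedges G. opp G h = h} = {b2 + 1}"
    using opp_root root_in_hedges edges_total edges_ends by fastforce
  moreover have "{0..<N} = V \<union> hedges G"
    using g by (auto simp: fields(2) N_eq)
  ultimately show ?thesis
    unfolding bw_graph_def using fin opp cyc by (auto simp: fields(1,7,8))
qed

section \<open>The unique labelling of the two trees\<close>

lemma trivalent: "trivalent G"
  using hedges_at_fork by (auto simp: trivalent_def black)

lemma degree: "degree G = 2 * g + 1"
proof -
  have "card (hedges_at G v) - 3 = 0" if "v \<in> black G" for v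
    using trivalent that by (simp add: trivalent_def)
  then show ?thesis by (simp add: degree_def fields(5) hedges_at_white k_def)
qed

text \<open>
  The numbering is chosen such that the canonical orientation lists all vertices and half-edges in
  increasing order: the white vertex 0, its half-edges 1, ..., k, and then one block of four consecutive
  numbers for each fork.
\<close>

lemma cut_sign: "cut_sign G = 1"
proof -
  have "sorted_list_of_set (black G) = map (\<lambda>i. b1 + 4 * i) [0..<2 * g - 1]"
  proof (rule sorted_distinct_set_unique)
    show "set (sorted_list_of_set (black G)) = set (map (\<lambda>i. b1 + 4 * i) [0..<2 * g - 1])"
      by (auto simp: black)
    show "sorted (map (\<lambda>i. b1 + 4 * i) [0..<2 * g - 1])" by (simp add: sorted_iff_nth_mono)
  qed (simp_all add: distinct_map inj_on_def)
  then have blocks: "concat (map (\<lambda>v. v # cyc G (Min (hedges_at G v))) (sorted_list_of_set (black G))) =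
      concat (map (\<lambda>i. (b1 + 4 * i) # cyc G (Min (hedges_at G (b1 + 4 * i)))) [0..<2 * g - 1])"
    by (simp add: comp_def)
  have "concat (map (\<lambda>i. (b1 + 4 * i) # cyc G (Min (hedges_at G (b1 + 4 * i)))) [0..<n]) = [b1..<b1 + 4 * n]"
    if "n \<le> 2 * g - 1" for n
    using that
  proof (induction n)
    case (Suc n)
    then have n: "n < 2 * g - 1" by simp
    have "Min {b1 + 4 * n + 1, b1 + 4 * n + 2, b1 + 4 * n + 3} = b1 + 4 * n + 1"
      by (intro Min_eqI) auto
    then have "(b1 + 4 * n) # cyc G (Min (hedges_at G (b1 + 4 * n))) =
        [b1 + 4 * n, b1 + 4 * n + 1, b1 + 4 * n + 2, b1 + 4 * n + 3]"
      unfolding hedges_at_fork[OF n] by (simp only: cyc_fork(1)[OF n])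
    moreover have "[b1..<b1 + 4 * Suc n] = [b1..<b1 + 4 * n] @
        [b1 + 4 * n, b1 + 4 * n + 1, b1 + 4 * n + 2, b1 + 4 * n + 3]"
      by (simp add: upt_add_eq_append[of b1 "b1 + 4 * n" 4, simplified] eval_nat_numeral)
    ultimately show ?case using Suc by simp
  qed simp
  from this[OF order.refl] have "cut_orientation G = 0 # cyc G 1 @ [b1..<N]"
    by (simp add: cut_orientation_def blocks fields(5,6) N_eq)
  also have "\<dots> = 0 # [1..<b1] @ [b1..<N]"
    using cyc_white[of 1] by (simp add: b1_k k_def)
  also have "\<dots> = [0..<N]"
  proof -
    have "[1..<b1] @ [b1..<N] = [1..<N]"
      using upt_add_eq_append[of 1 b1 "4 * (2 * g - 1)"] by (simp add: N_eq b1_def)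
    then show ?thesis using g by (simp add: N_eq b1_def upt_conv_Cons)
  qed
  finally show ?thesis by (simp add: cut_sign_def fields(8) list_sign_square)
qed

text \<open>
  The labelling which is 0 at the start half-edge and 1 at the other half-edges of the white
  vertex, and which at each fork is 1 towards the root and 0 towards the subtrees.
\<close>

definition forced :: "nat \<Rightarrow> nat" where
  "forced = restrict (\<lambda>h. if h \<le> k then of_bool (h \<noteq> 1) else of_bool ((h - b1) mod 4 = 1)) (hedges G)"

lemma forced_white: "forced 1 = 0" "h \<in> {2..k} \<Longrightarrow> forced h = 1"
  by (auto simp: forced_def hedges_eq k_def)

lemma fork_in_hedges:
  "i < 2 * g - 1 \<Longrightarrow> {b1 + 4 * i + 1, b1 + 4 * i + 2, b1 + 4 * i + 3} \<subseteq> hedges G"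
  using hedges_at_fork[of i] by (auto simp: hedges_at_def)

lemma forced_fork:
  assumes "i < 2 * g - 1"
  shows "forced (b1 + 4 * i + 1) = 1" "forced (b1 + 4 * i + 2) = 0" "forced (b1 + 4 * i + 3) = 0"
proof -
  have "forced (b1 + 4 * i + j) = of_bool (j = 1)" if "j \<in> {1, 2, 3}" for j
  proof -
    have "b1 + 4 * i + j - b1 = j + 4 * i" by simp
    then have m: "(b1 + 4 * i + j - b1) mod 4 = j" using that by (simp only: mod_mult_self2) auto
    have "b1 + 4 * i + j \<in> hedges G" using fork_in_hedges[OF assms] that by auto
    moreover have "\<not> b1 + 4 * i + j \<le> k" by (simp add: b1_k)
    ultimately show ?thesis by (simp only: forced_def restrict_apply m if_True if_False)
  qed
  from this[of 1] this[of 2] this[of 3]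
  show "forced (b1 + 4 * i + 1) = 1" "forced (b1 + 4 * i + 2) = 0" "forced (b1 + 4 * i + 3) = 0" by simp_all
qed

lemma odds_evens: "h \<in> set odds \<Longrightarrow> h \<in> {2..k}" "h \<in> set evens \<Longrightarrow> h \<in> {2..k}"
  using set_odds_evens by blast+

text \<open>
  The second tree is treated as two subtrees, since its root is a leaf and not on an edge: both subtrees
  force the label 0 on the half-edges above the lowest fork, so balance at that fork
  gives 1 on the incoming leaf.
\<close>

lemma balanced_forced:
  assumes c: "balanced G c" and ones: "\<And>h. h \<in> {2..k} \<Longrightarrow> c h = 1"
  shows "c 1 = 0" "i < 2 * g - 1 \<Longrightarrow> c (b1 + 4 * i + 1) = 1 \<and> c (b1 + 4 * i + 2) = 0 \<and> c (b1 + 4 * i + 3) = 0"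
proof -
  have edge: "c x + c y = 1" if "(x, y) \<in> set (E1 @ E2)" for x y
  proof -
    have "(x, y) \<in> edges" using that by (simp add: edges_def)
    then show ?thesis using edges_ends[of x y] opp_eq[of x y] c unfolding balanced_def by fastforce
  qed
  have fork: "c (b1 + 4 * i + 1) + c (b1 + 4 * i + 2) + c (b1 + 4 * i + 3) = 1" if "i < 2 * g - 1" for i
  proof -
    have "b1 + 4 * i \<in> black G" using that by (auto simp: black)
    then have "(\<Sum>h\<in>hedges_at G (b1 + 4 * i). c h) = 1" using c by (simp add: balanced_def)
    then show ?thesis unfolding hedges_at_fork[OF that] by simp
  qed
  obtain l r where T2: "legs l + legs r = g + 1"
    "E2 = tree_edges l (b2 + 2) (b2 + 4) (take (legs l) evens) @
      tree_edges r (b2 + 3) (b2 + 4 * legs l) (drop (legs l) evens)"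
    using T2_Fork by metis
  have len: "length evens = legs l + legs r" using T2(1) by simp
  have sub: "set (take (legs l) evens) \<subseteq> {2..k}" "set (drop (legs l) evens) \<subseteq> {2..k}"
    using set_take_subset[of "legs l" evens] set_drop_subset[of "legs l" evens] odds_evens(2) by blast+
  let ?m = "legs l - 1" and ?n = "legs r - 1"
  have mn: "g = ?m + ?n + 1" "4 * legs l = 4 * ?m + 4"
    using T2(1) legs_pos[of l] legs_pos[of r] by auto
  have A: "c 1 = 0 \<and> (\<forall>i < legs T1 - 1. c (b1 + 4 * i + 1) = 1 \<and> c (b1 + 4 * i + 2) = 0 \<and> c (b1 + 4 * i + 3) = 0)"
  proof (rule tree_forced)
    show "length odds = legs T1" by (simp add: legs1)
    show "c x + c y = 1" if "(x, y) \<in> set (tree_edges T1 1 b1 odds)" for x y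
      using that edge by (simp add: E1_def)
    show "c h = 1" if "h \<in> set odds" for h using that ones odds_evens(1) by blast
    show "c (b1 + 4 * i + 1) + c (b1 + 4 * i + 2) + c (b1 + 4 * i + 3) = 1" if "i < legs T1 - 1" for i
      using that by (intro fork) (simp add: legs1)
  qed
  then show "c 1 = 0" ..
  have L: "c (b2 + 2) = 0 \<and> (\<forall>i < ?m. c (b2 + 4 + 4 * i + 1) = 1 \<and> c (b2 + 4 + 4 * i + 2) = 0 \<and> c (b2 + 4 + 4 * i + 3) = 0)"
  proof (rule tree_forced)
    show "length (take (legs l) evens) = legs l"
      by (simp only: length_take len min_add_distrib_left min.absorb2 le_add1)
    show "c x + c y = 1" if "(x, y) \<in> set (tree_edges l (b2 + 2) (b2 + 4) (take (legs l) evens))" for x y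
      using that edge unfolding T2(2) set_append by blast
    show "c h = 1" if "h \<in> set (take (legs l) evens)" for h using that ones sub by blast
    show "c (b2 + 4 + 4 * i + 1) + c (b2 + 4 + 4 * i + 2) + c (b2 + 4 + 4 * i + 3) = 1" if "i < legs l - 1" for i
      using fork[of "g + i"] that mn g by (simp add: b2_eq algebra_simps)
  qed
  have R: "c (b2 + 3) = 0 \<and> (\<forall>i < ?n. c (b2 + 4 * legs l + 4 * i + 1) = 1 \<and> c (b2 + 4 * legs l + 4 * i + 2) = 0 \<and>
      c (b2 + 4 * legs l + 4 * i + 3) = 0)"
  proof (rule tree_forced)
    show "length (drop (legs l) evens) = legs r" by (simp only: length_drop len diff_add_inverse)
    show "c x + c y = 1" if "(x, y) \<in> set (tree_edges r (b2 + 3) (b2 + 4 * legs l) (drop (legs l) evens))" for x y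
      using that edge unfolding T2(2) set_append by blast
    show "c h = 1" if "h \<in> set (drop (legs l) evens)" for h using that ones sub by blast
    show "c (b2 + 4 * legs l + 4 * i + 1) + c (b2 + 4 * legs l + 4 * i + 2) + c (b2 + 4 * legs l + 4 * i + 3) = 1"
      if "i < legs r - 1" for i
    proof -
      have "b2 + 4 * legs l + 4 * i = b1 + 4 * (g + ?m + i)" "g + ?m + i < 2 * g - 1"
        using mn that g by (auto simp: b2_eq)
      then show ?thesis using fork by presburger
    qed
  qed
  show "c (b1 + 4 * i + 1) = 1 \<and> c (b1 + 4 * i + 2) = 0 \<and> c (b1 + 4 * i + 3) = 0" if i: "i < 2 * g - 1"
  proof -
    consider "i < g - 1" | "i = g - 1" | "g \<le> i" "i < g + ?m" | "g + ?m \<le> i" by linarith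
    then show ?thesis
    proof cases
      case 1 then show ?thesis using A by (simp add: legs1)
    next
      case 2
      have "b2 = b1 + 4 * i" by (simp add: b2_eq 2)
      then show ?thesis using fork[OF i] L R by simp
    next
      case 3
      then have "b2 + 4 + 4 * (i - g) = b1 + 4 * i" "i - g < ?m" using g by (auto simp: b2_eq)
      then show ?thesis using L by metis
    next
      case 4
      then have "b2 + 4 * legs l + 4 * (i - (g + ?m)) = b1 + 4 * i" "i - (g + ?m) < ?n"
        using g mn i by (auto simp: b2_eq)
      then show ?thesis using R by metis
    qed
  qed
qed

lemma balanced_forced_state: "balanced G forced"
proof -
  obtain l r where T2: "legs l + legs r = g + 1"
    "E2 = tree_edges l (b2 + 2) (b2 + 4) (take (legs l) evens) @
      tree_edges r (b2 + 3) (b2 + 4 * legs l) (drop (legs l) evens)"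
    using T2_Fork by metis
  have len: "length evens = legs l + legs r" using T2(1) by simp
  have sub: "set (take (legs l) evens) \<subseteq> {2..k}" "set (drop (legs l) evens) \<subseteq> {2..k}"
    using set_take_subset[of "legs l" evens] set_drop_subset[of "legs l" evens] odds_evens(2) by blast+
  let ?m = "legs l - 1" and ?n = "legs r - 1"
  have mn: "g = ?m + ?n + 1" "4 * legs l = 4 * ?m + 4"
    using T2(1) legs_pos[of l] legs_pos[of r] by auto
  have b2: "forced (b2 + 2) = 0" "forced (b2 + 3) = 0"
  proof -
    have "g - 1 < 2 * g - 1" using g by simp
    then show "forced (b2 + 2) = 0" "forced (b2 + 3) = 0"
      using forced_fork[of "g - 1"] by (simp_all only: b2_eq)
  qed
  have "forced x + forced y = 1" if "(x, y) \<in> set (E1 @ E2)" for x y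
  proof -
    consider "(x, y) \<in> set (tree_edges T1 1 b1 odds)"
      | "(x, y) \<in> set (tree_edges l (b2 + 2) (b2 + 4) (take (legs l) evens))"
      | "(x, y) \<in> set (tree_edges r (b2 + 3) (b2 + 4 * legs l) (drop (legs l) evens))"
      using \<open>(x, y) \<in> set (E1 @ E2)\<close> unfolding T2(2) E1_def set_append by blast
    then show ?thesis
    proof cases
      case 1
      then show ?thesis
      proof (rule tree_balanced[rotated -1])
        show "length odds = legs T1" by (simp add: legs1)
        show "forced h = 1" if "h \<in> set odds" for h using that forced_white odds_evens(1) by blast
        show "forced (b1 + 4 * i + 1) = 1 \<and> forced (b1 + 4 * i + 2) = 0 \<and> forced (b1 + 4 * i + 3) = 0"
          if "i < legs T1 - 1" for i
          using forced_fork[of i] that by (simp add: legs1)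
      qed (rule forced_white)
    next
      case 2
      then show ?thesis
      proof (rule tree_balanced[rotated -1])
        show "length (take (legs l) evens) = legs l"
          by (simp only: length_take len min_add_distrib_left min.absorb2 le_add1)
        show "forced h = 1" if "h \<in> set (take (legs l) evens)" for h using that forced_white sub by blast
        show "forced (b2 + 4 + 4 * i + 1) = 1 \<and> forced (b2 + 4 + 4 * i + 2) = 0 \<and> forced (b2 + 4 + 4 * i + 3) = 0"
          if "i < legs l - 1" for i
        proof -
          have "b2 + 4 + 4 * i = b1 + 4 * (g + i)" "g + i < 2 * g - 1"
            using mn that g by (auto simp: b2_eq)
          then show ?thesis using forced_fork by presburger
        qed
      qed (rule b2)
    next
      case 3
      then show ?thesis
      proof (rule tree_balanced[rotated -1])
        show "length (drop (legs l) evens) = legs r" by (simp only: length_drop len diff_add_inverse)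
        show "forced h = 1" if "h \<in> set (drop (legs l) evens)" for h using that forced_white sub by blast
        show "forced (b2 + 4 * legs l + 4 * i + 1) = 1 \<and> forced (b2 + 4 * legs l + 4 * i + 2) = 0 \<and>
            forced (b2 + 4 * legs l + 4 * i + 3) = 0"
          if "i < legs r - 1" for i
        proof -
          have "b2 + 4 * legs l + 4 * i = b1 + 4 * (g + ?m + i)" "g + ?m + i < 2 * g - 1"
            using mn that g by (auto simp: b2_eq)
          then show ?thesis using forced_fork by presburger
        qed
      qed (rule b2)
    qed
  qed
  note edge = this
  have edges: "forced x + forced y = 1" if "(x, y) \<in> edges" for x y
  proof -
    have "(x, y) \<in> set (E1 @ E2) \<or> (y, x) \<in> set (E1 @ E2)" using that by (auto simp: edges_def)
    then show ?thesis using edge add.commute by metis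
  qed
  have "forced h + forced (opp G h) = 1" if "h \<in> hedges G" "opp G h \<noteq> h" for h
    using that edges edges_total opp_root by metis
  moreover have "(\<Sum>h\<in>hedges_at G v. forced h) = 1" if "v \<in> black G" for v
  proof -
    obtain i where v: "v = b1 + 4 * i" "i < 2 * g - 1" using \<open>v \<in> black G\<close> by (auto simp: black)
    show ?thesis unfolding v(1) hedges_at_fork[OF v(2)] using forced_fork[OF v(2)] by simp
  qed
  ultimately show ?thesis by (simp add: balanced_def)
qed

lemma forced_unique:
  assumes "balanced G c" "\<And>h. h \<in> {2..k} \<Longrightarrow> c h = 1" "c \<in> extensional (hedges G)"
  shows "c = forced"
proof
  fix h
  show "c h = forced h"
  proof (cases "h \<in> hedges G")
    case True
    then show ?thesis
    proof (cases rule: hedges_cases)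
      case white
      then show ?thesis
        using balanced_forced(1)[OF assms(1,2)] assms(2) forced_white by (cases "h = 1") auto
    next
      case (fork i)
      then show ?thesis
        using balanced_forced(2)[OF assms(1,2) fork(1)] forced_fork[OF fork(1)] by fastforce
    qed
  qed (use assms(3) in \<open>simp add: forced_def extensional_def\<close>)
qed

lemma map_cyc_start: "map c (cyc G (start G)) = c 1 # map c [2..<Suc k]"
proof -
  have "[1..<Suc k] = 1 # [2..<Suc k]" by (simp add: upt_conv_Cons k_def numeral_2_eq_2 del: upt_Suc)
  then show ?thesis using cyc_white[of 1] by (simp add: fields(6) k_def del: upt_Suc)
qed

lemma forced_word: "map forced (cyc G (start G)) = 0 # replicate (2 * g + 1) 1"
proof -
  have "map forced [2..<Suc k] = map (\<lambda>_. 1) [2..<Suc k]"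
    by (intro map_cong[OF HOL.refl] forced_white(2)) auto
  also have "\<dots> = replicate (2 * g + 1) 1"
    by (simp only: map_replicate_const length_upt) (simp add: k_def)
  finally show ?thesis by (simp add: map_cyc_start forced_white(1)[simplified] del: upt_Suc)
qed

lemma forced_root: "forced (b2 + 1) = 1"
proof -
  have "g - 1 < 2 * g - 1" using g by simp
  then show ?thesis using forced_fork(1)[of "g - 1"] by (simp only: b2_eq)
qed

text \<open>
  Labellings whose output word survives in the reduced complex carry 1 at all white half-edges but the
  start, so they coincide with \<open>forced\<close>; it has the value 1 at the incoming leaf and
  thus belongs to the input x.
\<close>

lemma cut_op_t_graph:
  "cut_op G us = (if us = [1] then tens (0 # replicate (2 * g + 1) 1) else 0 :: nat list \<Rightarrow>\<^sub>0 'r::comm_ring_1)"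
proof -
  have root: "map c (labs G) = [c (b2 + 1)]" for c :: "nat \<Rightarrow> nat" by (simp add: fields(7))
  have zero: "tens (map c (cyc G (start G))) = (0 :: nat list \<Rightarrow>\<^sub>0 'r)" if "c \<in> states G us" "c \<noteq> forced" for c
  proof -
    have "balanced G c" "c \<in> extensional (hedges G)"
      using that(1) by (auto simp: states_def labellings_def PiE_def)
    then have "\<not> (\<forall>h\<in>{2..k}. c h = 1)" using forced_unique that(2) by blast
    then have "\<not> reduced_word (map c (cyc G (start G)))"
    proof (rule contrapos_nn)
      assume "reduced_word (map c (cyc G (start G)))"
      then have "c ` {2..<Suc k} \<subseteq> {1}" by (simp add: reduced_word_def map_cyc_start del: upt_Suc)
      then show "\<forall>h\<in>{2..k}. c h = 1" by (auto simp: less_Suc_eq_le image_subset_iff)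
    qed
    then show ?thesis by (simp add: tens_def)
  qed
  have forced_iff: "forced \<in> states G us \<longleftrightarrow> us = [1]"
  proof -
    have "forced \<in> hedges G \<rightarrow>\<^sub>E {0, 1}" by (auto simp: forced_def)
    moreover have "\<not> unlabelled_start G \<or> forced (start G) = 0" by (simp add: fields(6) forced_white(1)[simplified])
    ultimately show ?thesis
      using balanced_forced_state by (auto simp: states_def labellings_def root forced_root[simplified])
  qed
  have fin: "finite (states G us)"
    using finite_labellings[OF ribbon_if_bw_graph[OF bw_graph]] by (simp add: states_def)
  have "state_sum G us = (\<Sum>c\<in>states G us \<inter> {forced}. tens (map c (cyc G (start G))) :: nat list \<Rightarrow>\<^sub>0 'r)"
    unfolding state_sum_def using fin zero by (intro sum.mono_neutral_right) auto
  also have "\<dots> = (if us = [1] then tens (0 # replicate (2 * g + 1) 1) else 0)"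
  proof (cases "us = [1]")
    case True
    then have "states G us \<inter> {forced} = {forced}" using forced_iff by blast
    then show ?thesis using True by (simp only: forced_word sum.insert_if) (simp del: replicate_Suc add: forced_word[simplified])
  next
    case False
    then have "states G us \<inter> {forced} = {}" using forced_iff by blast
    then show ?thesis using False by simp
  qed
  finally show ?thesis
    by (simp add: cut_op_eq[OF ribbon_if_bw_graph[OF bw_graph]] trivalent cut_sign)
qed

end

section \<open>The reduced Hochschild complex\<close>

lemma hoch_chains_0_expand:
  assumes "c \<in> hoch_chains 0"
  shows "lin_ext f c = scale (Poly_Mapping.lookup c [0]) (f [0]) + scale (Poly_Mapping.lookup c [1]) (f [1])"
proof -
  have "w \<in> {[0], [1]}" if "w \<in> Poly_Mapping.keys c" for w
  proof -
    have "length w = 1" "reduced_word w" using that assms by (auto simp: hoch_chains_def)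
    then show ?thesis by (cases w) (auto simp: reduced_word_def)
  qed
  then have "Poly_Mapping.keys c \<subseteq> {[0], [1]}" by blast
  from lin_ext_superset[OF _ this] show ?thesis by simp
qed

lemma reduced_word_replicate: "reduced_word (a # replicate m 1) \<longleftrightarrow> a < 2"
  by (auto simp: reduced_word_def)

lemma reduced_word_cases:
  assumes "reduced_word w" "length w = Suc n"
  obtains a where "w = a # replicate n 1"
proof -
  obtain a v where w: "w = a # v" using assms(2) by (cases w) auto
  have "v = replicate n 1"
    using assms unfolding w by (intro replicate_eqI) (auto simp: reduced_word_def)
  with w that show ?thesis by blast
qed

text \<open>
  As A is commutative, the differential from degree 1 to degree 0 vanishes.
\<close>

lemma hoch_boundaries_0: "hoch_boundaries 0 = {0 :: nat list \<Rightarrow>\<^sub>0 'r::comm_ring_1}"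
proof -
  have "hoch_diff_word w = (0 :: nat list \<Rightarrow>\<^sub>0 'r)" if "length w = 2" "reduced_word w" for w
  proof -
    have "length w = Suc 1" "reduced_word w" using that by simp_all
    then obtain a where "w = a # replicate 1 1" using reduced_word_cases by blast
    then show ?thesis by (simp add: hoch_diff_word_def scale_minus_left)
  qed
  then have "hoch_diff c = 0" if "c \<in> hoch_chains (Suc 0)" for c :: "nat list \<Rightarrow>\<^sub>0 'r"
    using that unfolding hoch_diff_def lin_ext_def hoch_chains_def
    by (intro sum.neutral) auto
  moreover have "(0 :: nat list \<Rightarrow>\<^sub>0 'r) \<in> hoch_chains (Suc 0)" by (simp add: hoch_chains_def)
  ultimately show ?thesis unfolding hoch_boundaries_def by force
qed

lemma hh_class_0: "hh_class 0 z = {z :: nat list \<Rightarrow>\<^sub>0 'r::comm_ring_1}"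
  by (simp add: hh_class_def hoch_boundaries_0)

lemma hoch_cycles_0: "hoch_cycles 0 = (hoch_chains 0 :: (nat list \<Rightarrow>\<^sub>0 'r::comm_ring_1) set)"
proof -
  have "hoch_diff c = 0" if "c \<in> hoch_chains 0" for c :: "nat list \<Rightarrow>\<^sub>0 'r"
    unfolding hoch_diff_def hoch_chains_0_expand[OF that] by (simp add: hoch_diff_word_def)
  then show ?thesis by (auto simp: hoch_cycles_def)
qed

lemma inner_face_zero:
  assumes "i > 0" "Suc i \<le> m"
  shows "tens (take i (a # replicate m 1) @ [(a # replicate m 1) ! i + (a # replicate m 1) ! Suc i] @ xs) = 0"
proof -
  have "(a # replicate m 1) ! i + (a # replicate m 1) ! Suc i = (2 :: nat)"
    using assms by (simp add: nth_Cons')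
  moreover have "\<not> reduced_word (take i (a # replicate m 1) @ [2] @ xs)"
    using assms by (cases i) (auto simp: reduced_word_def)
  ultimately show ?thesis by (simp only: tens_def if_False)
qed

text \<open>
  All inner faces but the first multiply two factors x and vanish; the first and the last face both give
  x^(a+1) (x) x (x) ... (x) x.
\<close>

lemma hoch_diff_word_replicate:
  "hoch_diff_word (a # replicate (Suc m) 1) =
    scale (1 + (- 1) ^ Suc m) (tens ((a + 1) # replicate m 1) :: nat list \<Rightarrow>\<^sub>0 'r::comm_ring_1)"
proof -
  let ?w = "a # replicate (Suc m) 1"
  let ?f = "\<lambda>i. scale ((- 1) ^ i) (tens (take i ?w @ [?w ! i + ?w ! Suc i] @ drop (i + 2) ?w)) :: nat list \<Rightarrow>\<^sub>0 'r"
  have "(\<Sum>i<Suc m. ?f i) = ?f 0 + (\<Sum>i<m. ?f (Suc i))" by (rule sum.lessThan_Suc_shift)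
  also have "(\<Sum>i<m. ?f (Suc i)) = 0"
  proof (rule sum.neutral, rule ballI)
    fix i assume "i \<in> {..<m}"
    then have "Suc (Suc i) \<le> Suc m" by simp
    show "?f (Suc i) = 0" by (simp only: inner_face_zero[OF zero_less_Suc \<open>Suc (Suc i) \<le> Suc m\<close>] scale_0)
  qed
  also have "?f 0 = tens ((a + 1) # replicate m 1)" by simp
  finally have s: "(\<Sum>i<Suc m. ?f i) = tens ((a + 1) # replicate m 1)" by simp
  have "length ?w - 1 = Suc m" "\<not> length ?w \<le> 1" by simp_all
  moreover have "last ?w = 1" by (simp add: last_replicate)
  moreover have "butlast (tl ?w) = replicate m 1" 
    by (metis list.sel(3) butlast_snoc replicate_Suc replicate_append_same)
  ultimately have "hoch_diff_word ?w = (\<Sum>i<Suc m. ?f i) + scale ((- 1) ^ Suc m) (tens ((1 + a) # replicate m 1))"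
    unfolding hoch_diff_word_def by simp
  then show ?thesis unfolding s scale_add_left scale_1 by (simp only: add.commute[of 1 a])
qed

lemma top_word_cycle:
  assumes "odd n"
  shows "scale r (tens (0 # replicate n 1)) \<in> (hoch_cycles n :: (nat list \<Rightarrow>\<^sub>0 'r::comm_ring_1) set)"
proof -
  let ?w = "0 # replicate n 1"
  let ?c = "scale r (tens ?w) :: nat list \<Rightarrow>\<^sub>0 'r"
  obtain m where m: "n = Suc m" "even m" using assms by (cases n) auto
  have keys: "Poly_Mapping.keys ?c \<subseteq> {?w}"
    by (auto simp: in_keys_iff tens_def lookup_single when_def split: if_splits)
  then have "hoch_diff ?c = scale (Poly_Mapping.lookup ?c ?w) (hoch_diff_word ?w)"
    unfolding hoch_diff_def by (subst lin_ext_superset[OF _ keys]) auto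
  also have "hoch_diff_word ?w = (0 :: nat list \<Rightarrow>\<^sub>0 'r)"
    unfolding m(1) hoch_diff_word_replicate using m(2) by simp
  finally have "hoch_diff ?c = 0" by simp
  moreover have "?c \<in> hoch_chains n"
    using keys reduced_word_replicate[of 0 n] unfolding hoch_chains_def by auto
  ultimately show ?thesis by (simp add: hoch_cycles_def)
qed

text \<open>
  Every word in a differential begins with a positive exponent.
\<close>

lemma boundary_coefficient:
  assumes "b \<in> hoch_boundaries n" "n > 0"
  shows "Poly_Mapping.lookup b (0 # replicate n 1) = (0 :: 'r::comm_ring_1)"
proof -
  obtain c where c: "c \<in> hoch_chains (Suc n)" "b = hoch_diff c"
    using assms(1) by (auto simp: hoch_boundaries_def)
  have "Poly_Mapping.lookup (hoch_diff_word w) (0 # replicate n 1) = (0 :: 'r)" if "w \<in> Poly_Mapping.keys c" for w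
  proof -
    have w: "length w = Suc (Suc n)" "reduced_word w" using that c by (auto simp: hoch_chains_def)
    obtain a where v: "w = a # replicate (Suc n) 1" by (rule reduced_word_cases[OF w(2,1)])
    show ?thesis unfolding v by (simp only: hoch_diff_word_replicate) (auto simp: tens_def lookup_single when_def)
  qed
  then show ?thesis
    by (simp add: c(2) hoch_diff_def lin_ext_def lookup_sum)
qed

lemma hh_class_nonzero:
  assumes "n > 0" "r \<noteq> 0"
  shows "hh_class n (scale r (tens (0 # replicate n 1))) \<noteq> (hh_class n 0 :: (nat list \<Rightarrow>\<^sub>0 'r::comm_ring_1) set)"
proof
  let ?c = "scale r (tens (0 # replicate n 1)) :: nat list \<Rightarrow>\<^sub>0 'r"
  assume eq: "hh_class n ?c = hh_class n 0"
  have "0 \<in> (hoch_boundaries n :: (nat list \<Rightarrow>\<^sub>0 'r) set)"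
    unfolding hoch_boundaries_def
    by (rule image_eqI[of _ _ 0]) (simp_all add: hoch_diff_def lin_ext_def hoch_chains_def)
  then have "?c \<in> hh_class n ?c" unfolding hh_class_def by force
  then have "?c \<in> hoch_boundaries n" unfolding eq by (simp add: hh_class_def)
  from boundary_coefficient[OF this assms(1)] show False
    using assms(2) reduced_word_replicate[of 0 n] by (simp add: tens_def)
qed

lemma tens_1_chain: "tens [1] \<in> hoch_chains 0"
  by (auto simp: tens_def reduced_word_def hoch_chains_def)

context two_trees begin

lemma t_diagram_in_SD: "t_diagram T1 T2 \<in> SD 1 (2 * g + 1)"
proof -
  have "length (labs G) = 1" by (simp add: fields(7))
  then have "sd_diagram 1 G" using bw_graph by (auto simp: sd_diagram_def fields(7))
  then show ?thesis
    unfolding t_diagram_def SD_def by (intro imageI) (auto simp: degree)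
qed

lemma sd_action_t_diagram:
  fixes c :: "nat list \<Rightarrow>\<^sub>0 'r::comm_ring_1"
  assumes "c \<in> hoch_chains 0"
  shows "sd_action (t_diagram T1 T2) c =
    scale (Poly_Mapping.lookup c [1]) (tens (0 # replicate (2 * g + 1) 1))"
  unfolding t_diagram_def sd_action_single[OF assms] hoch_chains_0_expand[OF assms]
  by (simp add: cut_op_t_graph)

lemma sd_action_t_diagram_x:
  "sd_action (t_diagram T1 T2) (tens [1]) = (tens (0 # replicate (2 * g + 1) 1) :: nat list \<Rightarrow>\<^sub>0 'r::comm_ring_1)"
  unfolding sd_action_t_diagram[OF tens_1_chain] by (simp add: tens_def reduced_word_def)

lemma hh_map_t_diagram:
  fixes z :: "nat list \<Rightarrow>\<^sub>0 'r::comm_ring_1"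
  shows "hh_map (t_diagram T1 T2) q (hh_class 0 z) = hh_class q (sd_action (t_diagram T1 T2) z)"
  by (simp add: hh_map_def hh_class_0)

lemma hh_map_range:
  "hh_map (t_diagram T1 T2) (2 * g + 1) \<in> (HH 0 :: (nat list \<Rightarrow>\<^sub>0 'r::comm_ring_1) set set) \<rightarrow> HH (2 * g + 1)"
proof
  fix X :: "(nat list \<Rightarrow>\<^sub>0 'r) set" assume "X \<in> HH 0"
  then obtain z where z: "z \<in> hoch_chains 0" "X = hh_class 0 z"
    by (auto simp: HH_def hoch_cycles_0)
  then show "hh_map (t_diagram T1 T2) (2 * g + 1) X \<in> HH (2 * g + 1)"
    unfolding z(2) hh_map_t_diagram sd_action_t_diagram[OF z(1)] HH_def
    by (intro imageI top_word_cycle) simp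
qed

lemma hh_map_nonzero:
  "\<exists>X \<in> (HH 0 :: (nat list \<Rightarrow>\<^sub>0 'r::comm_ring_1) set set).
    hh_map (t_diagram T1 T2) (2 * g + 1) X \<noteq> hh_class (2 * g + 1) 0"
proof
  show "hh_class 0 (tens [1]) \<in> (HH 0 :: (nat list \<Rightarrow>\<^sub>0 'r) set set)"
    unfolding HH_def hoch_cycles_0 by (intro imageI tens_1_chain)
  show "hh_map (t_diagram T1 T2) (2 * g + 1) (hh_class 0 (tens [1] :: nat list \<Rightarrow>\<^sub>0 'r)) \<noteq> hh_class (2 * g + 1) 0"
    unfolding hh_map_t_diagram sd_action_t_diagram_x
    using hh_class_nonzero[of "2 * g + 1" "1 :: 'r"] by simp
qed

end

theorem proposition4p1:
  fixes g :: nat and T1 T2 :: btree and t :: "(bwgraph \<Rightarrow>\<^sub>0 int) set"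
  assumes "g \<ge> 1"
    and "legs T1 = g" and "legs T2 = g + 1"
    and "t = t_diagram T1 T2"
  shows "t \<in> SD 1 (2 * g + 1) \<and>
     sd_action t (tens [1] :: nat list \<Rightarrow>\<^sub>0 int) = tens (0 # replicate (2 * g + 1) 1) \<and>
     hh_map t (2 * g + 1) \<in> (HH 0 :: (nat list \<Rightarrow>\<^sub>0 int) set set) \<rightarrow> HH (2 * g + 1) \<and>
     (\<exists>X \<in> (HH 0 :: (nat list \<Rightarrow>\<^sub>0 int) set set).
        hh_map t (2 * g + 1) X \<noteq> hh_class (2 * g + 1) 0) \<and>
     hh_map t (2 * g + 1) \<in> (HH 0 :: (nat list \<Rightarrow>\<^sub>0 rat) set set) \<rightarrow> HH (2 * g + 1) \<and>
     (\<exists>X \<in> (HH 0 :: (nat list \<Rightarrow>\<^sub>0 rat) set set).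
        hh_map t (2 * g + 1) X \<noteq> hh_class (2 * g + 1) 0)"
proof -
  interpret two_trees T1 T2 g "2 * g + 2" "2 * g + 3" "2 * g + 3 + 4 * (g - 1)" "10 * g - 1"
    by unfold_locales (use assms in simp_all)
  show ?thesis
    unfolding assms(4)
    by (intro conjI t_diagram_in_SD sd_action_t_diagram_x hh_map_range hh_map_nonzero)
qed

end
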